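(* Let $q\in\mathbb{C}^*$ be generic. Let $V=\mathbb{C}[t,t^{-1}]$ be the basic $\mathcal{L}_q(2)$-module, with $x f(t)=f(qt)$, $y f(t)=t f(t)$. Let $A=\begin{pmatrix} a_{11} & a_{12} \\ a_{21} & a_{22} \end{pmatrix}\in\mathrm{SL}_2(\mathbb{Z})$, $\underline{c}=(c_1,c_2)^T\in(\mathbb{C}^* )^2$, let $\tau=\tau_{\underline{c}}\tau_A$ be the automorphism of $\mathcal{L}_q(2)$ given by $$\tau(x)=c_1^{a_{11}}c_2^{a_{21}}x^{a_{11}}y^{a_{21}},\qquad\tau(y)=c_1^{a_{12}}c_2^{a_{22}}x^{a_{12}}y^{a_{22}},$$ and let $V^\tau$ be the twist of $V$ by $\tau$. Then the restriction $V^\tau|_{\mathcal{A}_q(2)}$ of $V^\tau$ to the subalgebra $\mathcal{A}_q(2)$ is a simple $\mathcal{A}_q(2)$-module if and only if $a_{21}a_{22}<0$. In this case, $V^\tau|_{\mathcal{A}_q(2)}$ is isomorphic to the simple $\mathcal{A}_q(2)$-module $L_{(a,b)}[c_1^{\varepsilon}]$ with $(a,b)=(|a_{22}|,|a_{21}|)$ and $\varepsilon=\mathrm{sign}(a_{22})=\pm1$.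
   Context: Generic means that $q$ is not a root of unity. $\mathcal{L}_q(2)$ is the associative unital $\mathbb{C}$-algebra generated by $x^{\pm1},y^{\pm1}$ with relation $xy=q\,yx$, and $\mathcal{A}_q(2)$ is its subalgebra generated by $x,y$ (which is the algebra with generators $x,y$ and the single relation $xy=q\,yx$). The twisted module $V^\tau$ is the vector space $V$ with action $u\star f=\tau(u)f$ for $u\in\mathcal{L}_q(2)$, $f\in V$. For co-prime positive integers $(a,b)$ and $[\lambda]\in\mathbb{C}^*/q^{\mathbb{Z}}$ (where $q^{\mathbb{Z}}=\{q^m\mid m\in\mathbb{Z}\}$), $L_{(a,b)}[\lambda]$ denotes the simple $\mathcal{A}_q(2)$-module cyclically generated by an eigenvector of $K=x^ay^b$ with eigenvalue $\lambda$ (it exists, is unique up to isomorphism, and depends only on the class $[\lambda]$). *)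

theory Defs
  imports
    "HOL-Analysis.Determinants"
    "HOL-Algebra.QuotRing"
    "HOL-Algebra.Generated_Rings"
    "HOL-Algebra.Module"
    "HOL-Algebra.Algebraic_Closure_Type"
    "HOL-Library.Poly_Mapping"
begin

section \<open>Left modules over a not necessarily commutative ring\<close>

text \<open>
  The axioms are those of the library locale \<^locale>\<open>module\<close>, which however requires the ring
  to be commutative.  As usual in HOL-Algebra, the fields for multiplication and one of the module
  record are ignored.  A module over a \<open>\<complex>\<close>-algebra is a module over its underlying ring; the
  \<open>\<complex>\<close>-vector space structure comes from the action of the constants.
\<close>

locale left_module = R?: ring R + M?: abelian_group M
  for R :: "('a, 'c) ring_scheme" (structure)
    and M :: "('a, 'b, 'd) module_scheme" (structure) +
  assumes smult_closed [simp, intro]: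
      "\<lbrakk>a \<in> carrier R; v \<in> carrier M\<rbrakk> \<Longrightarrow> a \<odot>\<^bsub>M\<^esub> v \<in> carrier M"
    and smult_l_distr:
      "\<lbrakk>a \<in> carrier R; b \<in> carrier R; v \<in> carrier M\<rbrakk> \<Longrightarrow>
        (a \<oplus>\<^bsub>R\<^esub> b) \<odot>\<^bsub>M\<^esub> v = a \<odot>\<^bsub>M\<^esub> v \<oplus>\<^bsub>M\<^esub> b \<odot>\<^bsub>M\<^esub> v"
    and smult_r_distr:
      "\<lbrakk>a \<in> carrier R; v \<in> carrier M; w \<in> carrier M\<rbrakk> \<Longrightarrow>
        a \<odot>\<^bsub>M\<^esub> (v \<oplus>\<^bsub>M\<^esub> w) = a \<odot>\<^bsub>M\<^esub> v \<oplus>\<^bsub>M\<^esub> a \<odot>\<^bsub>M\<^esub> w"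
    and smult_assoc1:
      "\<lbrakk>a \<in> carrier R; b \<in> carrier R; v \<in> carrier M\<rbrakk> \<Longrightarrow>
        (a \<otimes>\<^bsub>R\<^esub> b) \<odot>\<^bsub>M\<^esub> v = a \<odot>\<^bsub>M\<^esub> (b \<odot>\<^bsub>M\<^esub> v)"
    and smult_one [simp]: "v \<in> carrier M \<Longrightarrow> \<one>\<^bsub>R\<^esub> \<odot>\<^bsub>M\<^esub> v = v"

definition simple_module ::
    "('a, 'c) ring_scheme \<Rightarrow> ('a, 'b, 'd) module_scheme \<Rightarrow> bool" where
  "simple_module R M \<longleftrightarrow>
     left_module R M \<and> carrier M \<noteq> {\<zero>\<^bsub>M\<^esub>} \<and>
     (\<forall>N. submodule N R M \<longrightarrow> N = {\<zero>\<^bsub>M\<^esub>} \<or> N = carrier M)"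

definition module_isomorphic ::
    "('a, 'c) ring_scheme \<Rightarrow> ('a, 'b, 'd) module_scheme \<Rightarrow> ('a, 'e, 'f) module_scheme \<Rightarrow> bool"
  where
  "module_isomorphic R M N \<longleftrightarrow>
     (\<exists>\<phi>. bij_betw \<phi> (carrier M) (carrier N) \<and>
        (\<forall>v\<in>carrier M. \<forall>w\<in>carrier M. \<phi> (v \<oplus>\<^bsub>M\<^esub> w) = \<phi> v \<oplus>\<^bsub>N\<^esub> \<phi> w) \<and>
        (\<forall>u\<in>carrier R. \<forall>v\<in>carrier M. \<phi> (u \<odot>\<^bsub>M\<^esub> v) = u \<odot>\<^bsub>N\<^esub> \<phi> v))"

definition twist ::
    "('a \<Rightarrow> 'a) \<Rightarrow> ('a, 'b, 'd) module_scheme \<Rightarrow> ('a, 'b, 'd) module_scheme" where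
  "twist \<tau> M = M\<lparr>smult := \<lambda>u v. \<tau> u \<odot>\<^bsub>M\<^esub> v\<rparr>"


section \<open>The free algebra on \<open>x, x\<inverse>, y, y\<inverse>\<close>\<close>

datatype letter = Lx | Lxinv | Ly | Lyinv

text \<open>
  The free monoid, written additively so that \<open>mon \<Rightarrow>\<^sub>0 complex\<close> with the convolution product
  of \<^theory>\<open>HOL-Library.Poly_Mapping\<close> is the free associative unital algebra.
\<close>

datatype mon = Mon "letter list"

instantiation mon :: monoid_add
begin

definition zero_mon :: mon where "0 = Mon []"

fun plus_mon :: "mon \<Rightarrow> mon \<Rightarrow> mon" where "Mon u + Mon v = Mon (u @ v)"

instance
proof
  fix a b c :: mon
  show "a + b + c = a + (b + c)" by (cases a; cases b; cases c) simp
  show "0 + a = a" "a + 0 = a" by (cases a; simp add: zero_mon_def)+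
qed

end

type_synonym free_alg = "mon \<Rightarrow>\<^sub>0 complex"

abbreviation free_const :: "complex \<Rightarrow> free_alg" where
  "free_const c \<equiv> Poly_Mapping.single 0 c"

abbreviation free_gen :: "letter \<Rightarrow> free_alg" where
  "free_gen l \<equiv> Poly_Mapping.single (Mon [l]) 1"

abbreviation free_ring :: "free_alg ring" where
  "free_ring \<equiv> ring_of_type_algebra"


section \<open>The quantum torus \<open>\<L>\<^sub>q(2)\<close> and the quantum plane \<open>\<A>\<^sub>q(2)\<close>\<close>

definition relators :: "complex \<Rightarrow> free_alg set" where
  "relators q =
     {free_gen Lx * free_gen Lxinv - 1, free_gen Lxinv * free_gen Lx - 1,
      free_gen Ly * free_gen Lyinv - 1, free_gen Lyinv * free_gen Ly - 1,
      free_gen Lx * free_gen Ly - free_const q * (free_gen Ly * free_gen Lx)}"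

definition rel_ideal :: "complex \<Rightarrow> free_alg set" where
  "rel_ideal q = genideal free_ring (relators q)"

type_synonym qtorus_elt = "free_alg set"

definition qtorus :: "complex \<Rightarrow> qtorus_elt ring" where
  "qtorus q = free_ring Quot rel_ideal q"

definition qclass :: "complex \<Rightarrow> free_alg \<Rightarrow> qtorus_elt" where
  "qclass q p = rel_ideal q +>\<^bsub>free_ring\<^esub> p"

definition qconst :: "complex \<Rightarrow> complex \<Rightarrow> qtorus_elt" where
  "qconst q c = qclass q (free_const c)"

definition qx :: "complex \<Rightarrow> qtorus_elt" where
  "qx q = qclass q (free_gen Lx)"

definition qy :: "complex \<Rightarrow> qtorus_elt" where
  "qy q = qclass q (free_gen Ly)"

text \<open>The subalgebra generated by \<open>x, y\<close> is the subring generated by the constants and \<open>x, y\<close>.\<close>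

definition qplane :: "complex \<Rightarrow> qtorus_elt ring" where
  "qplane q =
     (qtorus q)\<lparr>carrier := generate_ring (qtorus q) (range (qconst q) \<union> {qx q, qy q})\<rparr>"

definition qtorus_auts :: "complex \<Rightarrow> (qtorus_elt \<Rightarrow> qtorus_elt) set" where
  "qtorus_auts q = {\<tau> \<in> ring_iso (qtorus q) (qtorus q). \<forall>c. \<tau> (qconst q c) = qconst q c}"

definition generic :: "complex \<Rightarrow> bool" where
  "generic q \<longleftrightarrow> q \<noteq> 0 \<and> (\<forall>n::nat. n > 0 \<longrightarrow> q ^ n \<noteq> 1)"


section \<open>The basic module \<open>\<complex>[t, t\<inverse>]\<close>\<close>

text \<open>
  Laurent polynomials are finitely supported coefficient families indexed by the exponent of
  \<open>t\<close>, with the convolution product.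
\<close>

type_synonym laurent = "int \<Rightarrow>\<^sub>0 complex"

text \<open>\<open>f(t) \<mapsto> f(q t)\<close>\<close>

definition dilate :: "complex \<Rightarrow> laurent \<Rightarrow> laurent" where
  "dilate q f = (\<Sum>n\<in>Poly_Mapping.keys f. Poly_Mapping.single n (Poly_Mapping.lookup f n * q powi n))"

text \<open>
  Since \<open>x\<^sup>\<plusminus>\<^sup>1, y\<^sup>\<plusminus>\<^sup>1\<close> and the constants generate \<^const>\<open>qtorus\<close> as a ring, these
  clauses determine the module up to the ignored record fields.
\<close>

definition basic_module :: "complex \<Rightarrow> (qtorus_elt, laurent) module \<Rightarrow> bool" where
  "basic_module q V \<longleftrightarrow>
     left_module (qtorus q) V \<and>
     carrier V = UNIV \<and> (\<forall>f g. f \<oplus>\<^bsub>V\<^esub> g = f + g) \<and>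
     (\<forall>c f. qconst q c \<odot>\<^bsub>V\<^esub> f = Poly_Mapping.single 0 c * f) \<and>
     (\<forall>f. qx q \<odot>\<^bsub>V\<^esub> f = dilate q f) \<and>
     (\<forall>f. qy q \<odot>\<^bsub>V\<^esub> f = Poly_Mapping.single 1 1 * f)"


section \<open>The simple modules \<open>L\<^bsub>(a,b)\<^esub>[\<lambda>]\<close>\<close>

definition qZ_class :: "complex \<Rightarrow> complex \<Rightarrow> complex set" where
  "qZ_class q l = {l * q powi m | m :: int. True}"

definition qK :: "complex \<Rightarrow> nat \<Rightarrow> nat \<Rightarrow> qtorus_elt" where
  "qK q a b = qx q [^]\<^bsub>qtorus q\<^esub> a \<otimes>\<^bsub>qtorus q\<^esub> qy q [^]\<^bsub>qtorus q\<^esub> b"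

text \<open>
  \<open>is_L q a b \<Lambda> M\<close> says that \<open>M\<close> is a model of \<open>L\<^bsub>(a,b)\<^esub>[\<lambda>]\<close>, where \<open>\<Lambda>\<close> is the coset \<open>[\<lambda>]\<close>;
  models exist and are unique up to isomorphism.
\<close>

definition is_L ::
    "complex \<Rightarrow> nat \<Rightarrow> nat \<Rightarrow> complex set \<Rightarrow> (qtorus_elt, 'b) module \<Rightarrow> bool" where
  "is_L q a b \<Lambda> M \<longleftrightarrow>
     simple_module (qplane q) M \<and>
     (\<exists>l\<in>\<Lambda>. \<exists>v\<in>carrier M. v \<noteq> \<zero>\<^bsub>M\<^esub> \<and>
        qK q a b \<odot>\<^bsub>M\<^esub> v = qconst q l \<odot>\<^bsub>M\<^esub> v \<and>
        carrier M = (\<lambda>u. u \<odot>\<^bsub>M\<^esub> v) ` carrier (qplane q))"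

end

theory Submission
  imports Defs
begin

text \<open>
  In the twisted module the generators act on the powers of \<open>t\<close> as weighted shifts,
  \<open>x\<close> by \<open>a\<^sub>2\<^sub>1\<close> and \<open>y\<close> by \<open>a\<^sub>2\<^sub>2\<close>.  If these steps do not have opposite signs, one half of the
  powers of \<open>t\<close> spans a proper submodule.  If they do, then \<open>K = x\<^sup>a y\<^sup>b\<close> fixes every line
  \<open>\<complex> t\<^sup>n\<close>, and since \<open>det A = 1\<close> its eigenvalue there is \<open>c\<^sub>1\<close> to the power \<open>\<epsilon>\<close> times \<open>q\<close> to the
  power \<open>\<epsilon> n + m\<close> with \<open>m\<close> constant.  As \<open>q\<close> is generic, these eigenvalues are distinct, so a nonzero
  submodule contains some \<open>t\<^sup>n\<close>, from which the coprime steps of opposite sign reach every other one.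
  For the isomorphism, monomials sending \<open>t\<^sup>n\<close> to multiples of the same \<open>t\<^sup>k\<close> differ, up to a scalar,
  by a power of \<open>K\<close>; so \<open>u t\<^sup>n \<mapsto> u v\<close> is well defined for every eigenvector \<open>v\<close> of \<open>K\<close>
  with the eigenvalue of \<open>t\<^sup>n\<close>, and a nonzero homomorphism of simple modules is bijective.
\<close>

section \<open>The quantum torus and the quantum plane\<close>

lemma ring_ring_of_type_algebra: "ring (ring_of_type_algebra :: 'a :: ring_1 ring)"
proof -
  have "\<exists>y. x + y = 0" for x :: 'a
    using add.right_inverse by blast
  then show ?thesis
    unfolding ring_of_type_algebra_def using add.right_inverse
    by unfold_locales (auto simp: algebra_simps Units_def)
qed

lemma ideal_rel_ideal: "ideal (rel_ideal q) free_ring"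
  unfolding rel_ideal_def
  by (rule ring.genideal_ideal[OF ring_ring_of_type_algebra]) (simp add: ring_of_type_algebra_def)

lemma ring_qtorus: "ring (qtorus q)"
  unfolding qtorus_def by (rule ideal.quotient_is_ring[OF ideal_rel_ideal])

interpretation qtorus: ring "qtorus q" for q
  by (rule ring_qtorus)

lemma qclass_hom: "qclass q \<in> ring_hom free_ring (qtorus q)"
  unfolding qclass_def[abs_def] qtorus_def by (rule ideal.rcos_ring_hom[OF ideal_rel_ideal])

lemma qclass_closed [simp]: "qclass q p \<in> carrier (qtorus q)"
  using ring_hom_memE(1)[OF qclass_hom] by (simp add: ring_of_type_algebra_def)

lemma qclass_mult: "qclass q p \<otimes>\<^bsub>qtorus q\<^esub> qclass q p' = qclass q (p * p')"
  using ring_hom_memE(2)[OF qclass_hom, of p p'] by (simp add: ring_of_type_algebra_def)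

lemma qclass_add: "qclass q p \<oplus>\<^bsub>qtorus q\<^esub> qclass q p' = qclass q (p + p')"
  using ring_hom_memE(3)[OF qclass_hom, of p p'] by (simp add: ring_of_type_algebra_def)

lemma qclass_one: "qclass q 1 = \<one>\<^bsub>qtorus q\<^esub>"
  using ring_hom_memE(4)[OF qclass_hom] by (simp add: ring_of_type_algebra_def)

lemma qclass_eqI:
  assumes "p - p' \<in> relators q"
  shows "qclass q p = qclass q p'"
proof -
  interpret I: ideal "rel_ideal q" free_ring by (rule ideal_rel_ideal)
  have "p - p' \<in> rel_ideal q"
    using assms I.genideal_self[of "relators q"]
    by (auto simp: rel_ideal_def ring_of_type_algebra_def)
  moreover have "p = (p - p') + p'" by simp
  ultimately have "p \<in> rel_ideal q +>\<^bsub>free_ring\<^esub> p'"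
    by (auto simp: a_r_coset_def' ring_of_type_algebra_def intro!: bexI[of _ "p - p'"])
  then show ?thesis
    unfolding qclass_def
    by (rule I.a_repr_independence'[symmetric]) (simp add: ring_of_type_algebra_def)
qed

lemma qgen_closed [simp]:
  "qconst q c \<in> carrier (qtorus q)" "qx q \<in> carrier (qtorus q)" "qy q \<in> carrier (qtorus q)"
  by (simp_all add: qconst_def qx_def qy_def)

lemma qconst_mult: "qconst q c \<otimes>\<^bsub>qtorus q\<^esub> qconst q d = qconst q (c * d)"
  by (simp add: qconst_def qclass_mult mult_single)

lemma qconst_add: "qconst q c \<oplus>\<^bsub>qtorus q\<^esub> qconst q d = qconst q (c + d)"
  by (simp add: qconst_def qclass_add single_add)

lemma qconst_one: "qconst q 1 = \<one>\<^bsub>qtorus q\<^esub>"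
  by (simp add: qconst_def qclass_one)

lemma qx_qconst: "qx q \<otimes>\<^bsub>qtorus q\<^esub> qconst q c = qconst q c \<otimes>\<^bsub>qtorus q\<^esub> qx q"
  by (simp add: qconst_def qx_def qclass_mult mult_single)

lemma qy_qconst: "qy q \<otimes>\<^bsub>qtorus q\<^esub> qconst q c = qconst q c \<otimes>\<^bsub>qtorus q\<^esub> qy q"
  by (simp add: qconst_def qy_def qclass_mult mult_single)

lemma qx_qy: "qx q \<otimes>\<^bsub>qtorus q\<^esub> qy q = qconst q q \<otimes>\<^bsub>qtorus q\<^esub> (qy q \<otimes>\<^bsub>qtorus q\<^esub> qx q)"
  unfolding qx_def qy_def qconst_def qclass_mult
  by (rule qclass_eqI) (simp add: relators_def)

lemma qx_Units: "qx q \<in> Units (qtorus q)"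
proof -
  have "qx q \<otimes>\<^bsub>qtorus q\<^esub> qclass q (free_gen Lxinv) = \<one>\<^bsub>qtorus q\<^esub>"
    "qclass q (free_gen Lxinv) \<otimes>\<^bsub>qtorus q\<^esub> qx q = \<one>\<^bsub>qtorus q\<^esub>"
    unfolding qx_def qclass_mult qclass_one[symmetric]
    by (rule qclass_eqI; simp add: relators_def)+
  then show ?thesis
    unfolding Units_def using qgen_closed(2) qclass_closed by blast
qed

lemma qy_Units: "qy q \<in> Units (qtorus q)"
proof -
  have "qy q \<otimes>\<^bsub>qtorus q\<^esub> qclass q (free_gen Lyinv) = \<one>\<^bsub>qtorus q\<^esub>"
    "qclass q (free_gen Lyinv) \<otimes>\<^bsub>qtorus q\<^esub> qy q = \<one>\<^bsub>qtorus q\<^esub>"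
    unfolding qy_def qclass_mult qclass_one[symmetric]
    by (rule qclass_eqI; simp add: relators_def)+
  then show ?thesis
    unfolding Units_def using qgen_closed(3) qclass_closed by blast
qed

abbreviation qplane_gens :: "complex \<Rightarrow> qtorus_elt set" where
  "qplane_gens q \<equiv> range (qconst q) \<union> {qx q, qy q}"

lemma qplane_gens_closed: "qplane_gens q \<subseteq> carrier (qtorus q)"
  by auto

lemma ring_qplane: "ring (qplane q)"
  unfolding qplane_def by (rule qtorus.generate_ring_is_ring[OF qplane_gens_closed])

lemma qplane_simps:
  "carrier (qplane q) = generate_ring (qtorus q) (qplane_gens q)"
  "mult (qplane q) = mult (qtorus q)"
  "add (qplane q) = add (qtorus q)"
  "\<one>\<^bsub>qplane q\<^esub> = \<one>\<^bsub>qtorus q\<^esub>"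
  "\<zero>\<^bsub>qplane q\<^esub> = \<zero>\<^bsub>qtorus q\<^esub>"
  by (simp_all add: qplane_def)

lemma qplane_carrier_subset: "carrier (qplane q) \<subseteq> carrier (qtorus q)"
  unfolding qplane_simps by (rule qtorus.generate_ring_incl[OF qplane_gens_closed])

lemma qplane_gen [simp]:
  "qconst q c \<in> carrier (qplane q)" "qx q \<in> carrier (qplane q)" "qy q \<in> carrier (qplane q)"
  unfolding qplane_simps by (auto intro: generate_ring.incl)

text \<open>Negation becomes multiplication by the constant -1, so it is covered by the constants
  and products in \<open>qplane_induct\<close> and asks for no case of its own.\<close>

lemma qtorus_uminus:
  assumes "u \<in> carrier (qtorus q)"
  shows "\<ominus>\<^bsub>qtorus q\<^esub> u = qconst q (-1) \<otimes>\<^bsub>qtorus q\<^esub> u"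
proof -
  have 0: "qconst q 0 = \<zero>\<^bsub>qtorus q\<^esub>"
    using qconst_add[of q 0 0] by (metis add_0 qtorus.add.l_cancel_one' qgen_closed(1))
  have "(qconst q (-1) \<otimes>\<^bsub>qtorus q\<^esub> u) \<oplus>\<^bsub>qtorus q\<^esub> u
      = (qconst q (-1) \<oplus>\<^bsub>qtorus q\<^esub> qconst q 1) \<otimes>\<^bsub>qtorus q\<^esub> u"
    using assms by (subst qtorus.l_distr) (auto simp: qconst_one)
  also have "\<dots> = \<zero>\<^bsub>qtorus q\<^esub>"
    using assms by (simp add: qconst_add 0)
  finally show ?thesis
    using assms qtorus.minus_equality by simp
qed

lemma qplane_induct [consumes 1, case_names const x y add mult]:
  assumes u: "u \<in> carrier (qplane q)"
    and const: "\<And>c. P (qconst q c)" and x: "P (qx q)" and y: "P (qy q)"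
    and add: "\<And>u w. u \<in> carrier (qplane q) \<Longrightarrow> w \<in> carrier (qplane q) \<Longrightarrow> P u \<Longrightarrow> P w \<Longrightarrow>
      P (u \<oplus>\<^bsub>qplane q\<^esub> w)"
    and mult: "\<And>u w. u \<in> carrier (qplane q) \<Longrightarrow> w \<in> carrier (qplane q) \<Longrightarrow> P u \<Longrightarrow> P w \<Longrightarrow>
      P (u \<otimes>\<^bsub>qplane q\<^esub> w)"
  shows "P u"
  using u unfolding qplane_simps(1)
proof induction
  case one
  then show ?case using const[of 1] by (simp add: qconst_one)
next
  case (incl h)
  then show ?case using const x y by auto
next
  case (a_inv h)
  then have "h \<in> carrier (qplane q)" by (simp add: qplane_simps)
  then have "P (qconst q (-1) \<otimes>\<^bsub>qplane q\<^esub> h)"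
    using a_inv by (intro mult const) auto
  then show ?case
    using qplane_carrier_subset[of q] \<open>h \<in> carrier (qplane q)\<close> by (auto simp: qtorus_uminus qplane_simps)
next
  case (eng_add h1 h2)
  then show ?case using add[of h1 h2] by (simp add: qplane_simps)
next
  case (eng_mult h1 h2)
  then show ?case using mult[of h1 h2] by (simp add: qplane_simps)
qed

lemma qplane_nat_pow: "u [^]\<^bsub>qplane q\<^esub> (n::nat) = u [^]\<^bsub>qtorus q\<^esub> n"
  by (simp add: nat_pow_def qplane_simps)

section \<open>Modules over the quantum plane\<close>

locale qplane_module = left_module "qplane q" M
  for q :: complex and M :: "(qtorus_elt, 'b, 'd) module_scheme"
begin

lemma smult_zero_right [simp]:
  assumes "u \<in> carrier (qplane q)"
  shows "u \<odot>\<^bsub>M\<^esub> \<zero>\<^bsub>M\<^esub> = \<zero>\<^bsub>M\<^esub>"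
proof -
  have "u \<odot>\<^bsub>M\<^esub> \<zero>\<^bsub>M\<^esub> \<oplus>\<^bsub>M\<^esub> u \<odot>\<^bsub>M\<^esub> \<zero>\<^bsub>M\<^esub> = u \<odot>\<^bsub>M\<^esub> \<zero>\<^bsub>M\<^esub>"
    using assms by (subst smult_r_distr[symmetric]) auto
  then show ?thesis
    using assms M.add.l_cancel_one' by (metis M.zero_closed smult_closed)
qed

lemma const_smult_const:
  assumes "v \<in> carrier M"
  shows "qconst q c \<odot>\<^bsub>M\<^esub> (qconst q d \<odot>\<^bsub>M\<^esub> v) = qconst q (c * d) \<odot>\<^bsub>M\<^esub> v"
  using assms by (subst smult_assoc1[symmetric]) (auto simp: qplane_simps(2-5) qconst_mult)

lemma const_smult_add:
  assumes "v \<in> carrier M"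
  shows "qconst q (c + d) \<odot>\<^bsub>M\<^esub> v = qconst q c \<odot>\<^bsub>M\<^esub> v \<oplus>\<^bsub>M\<^esub> qconst q d \<odot>\<^bsub>M\<^esub> v"
  using assms by (subst smult_l_distr[symmetric]) (auto simp: qplane_simps(2-5) qconst_add)

lemma const_smult_one [simp]: "v \<in> carrier M \<Longrightarrow> qconst q 1 \<odot>\<^bsub>M\<^esub> v = v"
  using smult_one[of v] by (simp add: qplane_simps(2-5) qconst_one)

lemma const_smult_zero [simp]:
  assumes "v \<in> carrier M"
  shows "qconst q 0 \<odot>\<^bsub>M\<^esub> v = \<zero>\<^bsub>M\<^esub>"
proof -
  have "qconst q 0 \<odot>\<^bsub>M\<^esub> v \<oplus>\<^bsub>M\<^esub> qconst q 0 \<odot>\<^bsub>M\<^esub> v = qconst q 0 \<odot>\<^bsub>M\<^esub> v"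
    using const_smult_add[OF assms, of 0 0] by simp
  then show ?thesis
    using assms M.add.l_cancel_one' by (metis qplane_gen(1) smult_closed)
qed

lemma uminus_eq:
  assumes "v \<in> carrier M"
  shows "\<ominus>\<^bsub>M\<^esub> v = qconst q (-1) \<odot>\<^bsub>M\<^esub> v"
proof -
  have "qconst q (-1) \<odot>\<^bsub>M\<^esub> v \<oplus>\<^bsub>M\<^esub> v = \<zero>\<^bsub>M\<^esub>"
    using const_smult_add[OF assms, of "-1" 1] assms by simp
  then show ?thesis
    using assms by (intro M.minus_equality) auto
qed

lemma x_smult_const:
  assumes "v \<in> carrier M"
  shows "qx q \<odot>\<^bsub>M\<^esub> (qconst q c \<odot>\<^bsub>M\<^esub> v) = qconst q c \<odot>\<^bsub>M\<^esub> (qx q \<odot>\<^bsub>M\<^esub> v)"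
  using assms by (subst (1 2) smult_assoc1[symmetric]) (auto simp: qplane_simps(2-5) qx_qconst)

lemma y_smult_const:
  assumes "v \<in> carrier M"
  shows "qy q \<odot>\<^bsub>M\<^esub> (qconst q c \<odot>\<^bsub>M\<^esub> v) = qconst q c \<odot>\<^bsub>M\<^esub> (qy q \<odot>\<^bsub>M\<^esub> v)"
  using assms by (subst (1 2) smult_assoc1[symmetric]) (auto simp: qplane_simps(2-5) qy_qconst)

lemma x_smult_y:
  assumes "v \<in> carrier M"
  shows "qx q \<odot>\<^bsub>M\<^esub> (qy q \<odot>\<^bsub>M\<^esub> v) = qconst q q \<odot>\<^bsub>M\<^esub> (qy q \<odot>\<^bsub>M\<^esub> (qx q \<odot>\<^bsub>M\<^esub> v))"
proof -
  have "qx q \<odot>\<^bsub>M\<^esub> (qy q \<odot>\<^bsub>M\<^esub> v) = (qx q \<otimes>\<^bsub>qplane q\<^esub> qy q) \<odot>\<^bsub>M\<^esub> v"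
    using assms by (simp add: smult_assoc1)
  also have "\<dots> = (qconst q q \<otimes>\<^bsub>qplane q\<^esub> (qy q \<otimes>\<^bsub>qplane q\<^esub> qx q)) \<odot>\<^bsub>M\<^esub> v"
    by (simp add: qplane_simps(2-5) qx_qy)
  also have "\<dots> = qconst q q \<odot>\<^bsub>M\<^esub> (qy q \<odot>\<^bsub>M\<^esub> (qx q \<odot>\<^bsub>M\<^esub> v))"
    using assms by (simp add: smult_assoc1)
  finally show ?thesis .
qed

lemma smult_mem_of_gens:
  assumes "H \<subseteq> carrier M"
    and "\<And>v w. v \<in> H \<Longrightarrow> w \<in> H \<Longrightarrow> v \<oplus>\<^bsub>M\<^esub> w \<in> H"
    and "\<And>c v. v \<in> H \<Longrightarrow> qconst q c \<odot>\<^bsub>M\<^esub> v \<in> H"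
    and "\<And>v. v \<in> H \<Longrightarrow> qx q \<odot>\<^bsub>M\<^esub> v \<in> H" "\<And>v. v \<in> H \<Longrightarrow> qy q \<odot>\<^bsub>M\<^esub> v \<in> H"
    and "u \<in> carrier (qplane q)" "v \<in> H"
  shows "u \<odot>\<^bsub>M\<^esub> v \<in> H"
proof -
  \<comment> \<open>The vector is quantified inside the induction on \<open>u\<close>: in the
    product case the hypothesis for the left factor is applied to the vector that the right factor
    has produced.\<close>
  have "\<forall>v\<in>H. u \<odot>\<^bsub>M\<^esub> v \<in> H"
    using assms(6)
  proof (induction rule: qplane_induct)
    case (add u w)
    then show ?case using assms(1,2) by (auto simp: smult_l_distr subset_iff)
  next
    case (mult u w)
    then show ?case using assms(1) by (auto simp: smult_assoc1 subset_iff)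
  qed (use assms in auto)
  then show ?thesis using assms(7) by blast
qed

lemma submoduleI:
  assumes sub: "H \<subseteq> carrier M" and zero: "\<zero>\<^bsub>M\<^esub> \<in> H"
    and add: "\<And>v w. v \<in> H \<Longrightarrow> w \<in> H \<Longrightarrow> v \<oplus>\<^bsub>M\<^esub> w \<in> H"
    and const: "\<And>c v. v \<in> H \<Longrightarrow> qconst q c \<odot>\<^bsub>M\<^esub> v \<in> H"
    and x: "\<And>v. v \<in> H \<Longrightarrow> qx q \<odot>\<^bsub>M\<^esub> v \<in> H" and y: "\<And>v. v \<in> H \<Longrightarrow> qy q \<odot>\<^bsub>M\<^esub> v \<in> H"
  shows "submodule H (qplane q) M"
proof (intro submodule.intro submodule_axioms.intro)
  show "subgroup H (add_monoid M)"
  proof (rule M.add.subgroupI)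
    show "\<ominus>\<^bsub>M\<^esub> v \<in> H" if "v \<in> H" for v
      using const[OF that, of "-1"] that sub by (subst uminus_eq) auto
  qed (use sub zero add in auto)
qed (rule smult_mem_of_gens[OF sub add const x y])

lemma submoduleD:
  assumes "submodule H (qplane q) M"
  shows "H \<subseteq> carrier M" "\<zero>\<^bsub>M\<^esub> \<in> H" "v \<in> H \<Longrightarrow> w \<in> H \<Longrightarrow> v \<oplus>\<^bsub>M\<^esub> w \<in> H"
    "u \<in> carrier (qplane q) \<Longrightarrow> v \<in> H \<Longrightarrow> u \<odot>\<^bsub>M\<^esub> v \<in> H"
proof -
  interpret submodule H "qplane q" M by fact
  show "H \<subseteq> carrier M" "\<zero>\<^bsub>M\<^esub> \<in> H" "v \<in> H \<Longrightarrow> w \<in> H \<Longrightarrow> v \<oplus>\<^bsub>M\<^esub> w \<in> H"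
    using subset one_closed m_closed by auto
  show "u \<in> carrier (qplane q) \<Longrightarrow> v \<in> H \<Longrightarrow> u \<odot>\<^bsub>M\<^esub> v \<in> H"
    by (rule smult_closed)
qed

text \<open>The orbit of \<open>v\<close> is a submodule, and it is nonzero because it contains
  \<open>v\<close> itself.\<close>

lemma simple_cyclic:
  assumes simple: "simple_module (qplane q) M" and v: "v \<in> carrier M" "v \<noteq> \<zero>\<^bsub>M\<^esub>"
  shows "carrier M = (\<lambda>u. u \<odot>\<^bsub>M\<^esub> v) ` carrier (qplane q)"
proof -
  let ?H = "(\<lambda>u. u \<odot>\<^bsub>M\<^esub> v) ` carrier (qplane q)"
  have step: "u \<odot>\<^bsub>M\<^esub> w \<in> ?H" if "u \<in> carrier (qplane q)" "w \<in> ?H" for u w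
    using that v by (auto simp: smult_assoc1[symmetric])
  have "submodule ?H (qplane q) M"
  proof (rule submoduleI)
    show "\<zero>\<^bsub>M\<^esub> \<in> ?H"
      using v by (auto intro!: rev_image_eqI[of "qconst q 0"])
    show "w \<oplus>\<^bsub>M\<^esub> w' \<in> ?H" if "w \<in> ?H" "w' \<in> ?H" for w w'
      using that v by (auto simp: smult_l_distr[symmetric])
  qed (use v step in auto)
  moreover have "v \<in> ?H"
    using v by (auto intro!: rev_image_eqI[of "qconst q 1"])
  ultimately show ?thesis
    using simple v(2) unfolding simple_module_def by blast
qed

text \<open>The action of \<open>x^i y^j\<close>, with the powers of \<open>y\<close> applied first.
  Iterating the two endomorphisms lets inductions on exponents take place in the module instead of
  in the ring.\<close>

definition monom_act :: "nat \<Rightarrow> nat \<Rightarrow> 'b \<Rightarrow> 'b" where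
  "monom_act i j v = ((\<odot>\<^bsub>M\<^esub>) (qx q) ^^ i) (((\<odot>\<^bsub>M\<^esub>) (qy q) ^^ j) v)"

lemma x_pow_closed [simp]: "v \<in> carrier M \<Longrightarrow> ((\<odot>\<^bsub>M\<^esub>) (qx q) ^^ i) v \<in> carrier M"
  by (induction i) auto

lemma y_pow_closed [simp]: "v \<in> carrier M \<Longrightarrow> ((\<odot>\<^bsub>M\<^esub>) (qy q) ^^ j) v \<in> carrier M"
  by (induction j) auto

lemma monom_act_closed [simp]: "v \<in> carrier M \<Longrightarrow> monom_act i j v \<in> carrier M"
  by (simp add: monom_act_def)

lemma x_pow_const:
  "v \<in> carrier M \<Longrightarrow>
    ((\<odot>\<^bsub>M\<^esub>) (qx q) ^^ i) (qconst q c \<odot>\<^bsub>M\<^esub> v) = qconst q c \<odot>\<^bsub>M\<^esub> ((\<odot>\<^bsub>M\<^esub>) (qx q) ^^ i) v"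
  by (induction i) (auto simp: x_smult_const)

lemma y_pow_const:
  "v \<in> carrier M \<Longrightarrow>
    ((\<odot>\<^bsub>M\<^esub>) (qy q) ^^ i) (qconst q c \<odot>\<^bsub>M\<^esub> v) = qconst q c \<odot>\<^bsub>M\<^esub> ((\<odot>\<^bsub>M\<^esub>) (qy q) ^^ i) v"
  by (induction i) (auto simp: y_smult_const)

lemma x_pow_y:
  "v \<in> carrier M \<Longrightarrow> ((\<odot>\<^bsub>M\<^esub>) (qx q) ^^ i) (qy q \<odot>\<^bsub>M\<^esub> v) =
    qconst q (q ^ i) \<odot>\<^bsub>M\<^esub> (qy q \<odot>\<^bsub>M\<^esub> ((\<odot>\<^bsub>M\<^esub>) (qx q) ^^ i) v)"
  by (induction i) (auto simp: x_smult_const x_smult_y const_smult_const mult.commute)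

lemma x_pow_y_pow:
  "v \<in> carrier M \<Longrightarrow> ((\<odot>\<^bsub>M\<^esub>) (qx q) ^^ i) (((\<odot>\<^bsub>M\<^esub>) (qy q) ^^ j) v) =
    qconst q (q ^ (i * j)) \<odot>\<^bsub>M\<^esub> ((\<odot>\<^bsub>M\<^esub>) (qy q) ^^ j) (((\<odot>\<^bsub>M\<^esub>) (qx q) ^^ i) v)"
proof (induction j)
  case (Suc j)
  then show ?case
    by (simp add: x_pow_y y_smult_const const_smult_const power_add)
qed auto

lemma qK_smult:
  assumes "v \<in> carrier M"
  shows "qK q a b \<odot>\<^bsub>M\<^esub> v = monom_act a b v"
proof -
  have pow: "(u [^]\<^bsub>qplane q\<^esub> n) \<odot>\<^bsub>M\<^esub> w = ((\<odot>\<^bsub>M\<^esub>) u ^^ n) w"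
    if "u \<in> carrier (qplane q)" "w \<in> carrier M" for u w and n :: nat
    using that(2)
  proof (induction n arbitrary: w)
    case (Suc n)
    then show ?case
      using that(1) by (simp add: smult_assoc1 funpow_swap1)
  qed simp
  have "qK q a b = qx q [^]\<^bsub>qplane q\<^esub> a \<otimes>\<^bsub>qplane q\<^esub> qy q [^]\<^bsub>qplane q\<^esub> b"
    by (simp add: qK_def qplane_nat_pow qplane_simps(2-5))
  then show ?thesis
    using assms by (simp add: smult_assoc1 pow monom_act_def)
qed

lemma x_monom_act: "qx q \<odot>\<^bsub>M\<^esub> monom_act i j v = monom_act (Suc i) j v"
  by (simp add: monom_act_def)

text \<open>The additional \<open>y\<close> stands to the right of \<open>x^i\<close>; moving it to
  the front costs one factor \<open>q\<close> for each \<open>x\<close>.\<close>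

lemma y_monom_act:
  assumes "v \<in> carrier M"
  shows "monom_act i (Suc j) v = qconst q (q ^ i) \<odot>\<^bsub>M\<^esub> (qy q \<odot>\<^bsub>M\<^esub> monom_act i j v)"
  using assms by (simp add: monom_act_def x_pow_y)

text \<open>Copies of \<open>K\<close> are split off one at a time: bringing \<open>x^a\<close> past
  the remaining power of \<open>y\<close> costs a power of \<open>q\<close>, and then
  \<open>K\<close> acts on \<open>v\<close> by \<open>l\<close>. The resulting factor depends on
  \<open>l\<close> and the exponents but not on the module, which later allows two modules to be
  compared.\<close>

lemma monom_act_shift:
  assumes v: "v \<in> carrier M" and K: "monom_act a b v = qconst q l \<odot>\<^bsub>M\<^esub> v"
  shows "monom_act (i + s * a) (j + s * b) v =
    qconst q (\<Prod>r<s. l * q ^ (a * (j + r * b))) \<odot>\<^bsub>M\<^esub> monom_act i j v"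
proof -
  have shift1: "monom_act (i + a) (j + b) v = qconst q (l * q ^ (a * j)) \<odot>\<^bsub>M\<^esub> monom_act i j v"
    for i j
    using v K by (simp add: monom_act_def funpow_add x_pow_y_pow[of _ a j] y_pow_const x_pow_const
        const_smult_const mult.commute)
  show ?thesis
  proof (induction s)
    case (Suc s)
    have "monom_act (i + Suc s * a) (j + Suc s * b) v
        = monom_act ((i + s * a) + a) ((j + s * b) + b) v"
      by (simp add: algebra_simps)
    then show ?case
      using v Suc by (simp only: shift1) (simp add: const_smult_const mult_ac)
  qed (use v in auto)
qed

end

section \<open>Homomorphisms between modules over the quantum plane\<close>

lemma qplane_hom_of_gens:
  assumes "left_module (qplane q) M" "left_module (qplane q) N"
    and closed: "\<And>v. v \<in> carrier M \<Longrightarrow> \<phi> v \<in> carrier N"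
    and add: "\<And>v w. v \<in> carrier M \<Longrightarrow> w \<in> carrier M \<Longrightarrow> \<phi> (v \<oplus>\<^bsub>M\<^esub> w) = \<phi> v \<oplus>\<^bsub>N\<^esub> \<phi> w"
    and const: "\<And>c v. v \<in> carrier M \<Longrightarrow> \<phi> (qconst q c \<odot>\<^bsub>M\<^esub> v) = qconst q c \<odot>\<^bsub>N\<^esub> \<phi> v"
    and x: "\<And>v. v \<in> carrier M \<Longrightarrow> \<phi> (qx q \<odot>\<^bsub>M\<^esub> v) = qx q \<odot>\<^bsub>N\<^esub> \<phi> v"
    and y: "\<And>v. v \<in> carrier M \<Longrightarrow> \<phi> (qy q \<odot>\<^bsub>M\<^esub> v) = qy q \<odot>\<^bsub>N\<^esub> \<phi> v"
    and "u \<in> carrier (qplane q)" "v \<in> carrier M"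
  shows "\<phi> (u \<odot>\<^bsub>M\<^esub> v) = u \<odot>\<^bsub>N\<^esub> \<phi> v"
proof -
  interpret M: left_module "qplane q" M by fact
  interpret N: left_module "qplane q" N by fact
  have "\<forall>v\<in>carrier M. \<phi> (u \<odot>\<^bsub>M\<^esub> v) = u \<odot>\<^bsub>N\<^esub> \<phi> v"
    using assms(8)
  proof (induction rule: qplane_induct)
    case (add u w)
    then show ?case by (simp add: M.smult_l_distr N.smult_l_distr assms(4) closed)
  next
    case (mult u w)
    then show ?case by (simp add: M.smult_assoc1 N.smult_assoc1 closed)
  qed (simp_all add: const x y)
  then show ?thesis using assms(9) by blast
qed

text \<open>Schur's argument: the kernel is a submodule that misses \<open>v0\<close>, hence zero,
  and the image contains the orbit of the nonzero vector \<open>\<phi> v0\<close>, which is all of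
  \<open>N\<close>.\<close>

lemma simple_hom_isomorphic:
  assumes M: "simple_module (qplane q) M" and N: "simple_module (qplane q) N"
    and closed: "\<And>v. v \<in> carrier M \<Longrightarrow> \<phi> v \<in> carrier N"
    and add: "\<And>v w. v \<in> carrier M \<Longrightarrow> w \<in> carrier M \<Longrightarrow> \<phi> (v \<oplus>\<^bsub>M\<^esub> w) = \<phi> v \<oplus>\<^bsub>N\<^esub> \<phi> w"
    and smult: "\<And>u v. u \<in> carrier (qplane q) \<Longrightarrow> v \<in> carrier M \<Longrightarrow>
      \<phi> (u \<odot>\<^bsub>M\<^esub> v) = u \<odot>\<^bsub>N\<^esub> \<phi> v"
    and nz: "v0 \<in> carrier M" "\<phi> v0 \<noteq> \<zero>\<^bsub>N\<^esub>"
  shows "module_isomorphic (qplane q) M N"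
proof -
  interpret M: qplane_module q M
    using M by (simp add: qplane_module_def simple_module_def)
  interpret N: qplane_module q N
    using N by (simp add: qplane_module_def simple_module_def)
  have zero: "\<phi> \<zero>\<^bsub>M\<^esub> = \<zero>\<^bsub>N\<^esub>"
    using smult[of "qconst q 0" v0] nz(1) closed by simp
  have uminus: "\<phi> (\<ominus>\<^bsub>M\<^esub> v) = \<ominus>\<^bsub>N\<^esub> \<phi> v" if "v \<in> carrier M" for v
    using that by (simp add: M.uminus_eq N.uminus_eq closed smult)
  let ?ker = "{v \<in> carrier M. \<phi> v = \<zero>\<^bsub>N\<^esub>}"
  have "submodule ?ker (qplane q) M"
    by (rule M.submoduleI) (auto simp: zero add smult)
  then have ker: "?ker = {\<zero>\<^bsub>M\<^esub>}"
    using M nz unfolding simple_module_def by blast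
  have "inj_on \<phi> (carrier M)"
  proof (rule inj_onI)
    fix v w assume vw: "v \<in> carrier M" "w \<in> carrier M" "\<phi> v = \<phi> w"
    then have "v \<ominus>\<^bsub>M\<^esub> w \<in> ?ker"
      using closed by (simp add: M.M.minus_eq add uminus N.M.r_neg)
    then have "v \<ominus>\<^bsub>M\<^esub> w = \<zero>\<^bsub>M\<^esub>" using ker by blast
    then show "v = w" using vw M.M.minus_eq M.M.minus_minus M.M.minus_equality M.M.a_inv_closed
      by metis
  qed
  moreover have "\<phi> ` carrier M = carrier N"
  proof
    show "carrier N \<subseteq> \<phi> ` carrier M"
      unfolding N.simple_cyclic[OF N closed[OF nz(1)] nz(2)]
      using nz(1) smult by (auto intro!: rev_image_eqI[of "_ \<odot>\<^bsub>M\<^esub> v0"])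
  qed (use closed in auto)
  ultimately show ?thesis
    unfolding module_isomorphic_def bij_betw_def using add smult by blast
qed

section \<open>Weighted shifts on Laurent polynomials\<close>

lemma poly_mapping_single_add_induct [case_names single add]:
  fixes f :: "'a \<Rightarrow>\<^sub>0 'b::comm_monoid_add"
  assumes single: "\<And>k c. P (Poly_Mapping.single k c)" and add: "\<And>f g. P f \<Longrightarrow> P g \<Longrightarrow> P (f + g)"
  shows "P f"
proof -
  have "P (\<Sum>k\<in>S. Poly_Mapping.single k (Poly_Mapping.lookup f k))" if "finite S" for S
    using that
  proof induction
    case empty
    \<comment> \<open>The zero mapping is a monomial with coefficient 0, at an arbitrary
      key.\<close>
    then show ?case using single[of undefined 0] by simp
  qed (simp add: single add)
  moreover have "(\<Sum>k\<in>Poly_Mapping.keys f. Poly_Mapping.single k (Poly_Mapping.lookup f k)) = f"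
    by (rule poly_mapping_eqI)
      (auto simp: lookup_sum lookup_single when_def sum.delta in_keys_iff)
  ultimately show ?thesis by (metis finite_keys)
qed

lemma single_one_nz: "Poly_Mapping.single n (1 :: 'b::zero_neq_one) \<noteq> 0"
  by (metis lookup_single_eq lookup_zero zero_neq_one)

text \<open>For the twist by \<open>\<tau>\<close>, the steps \<open>d1\<close>, \<open>d2\<close>
  are the second row of \<open>A\<close> and the weights \<open>p1\<close>, \<open>p2\<close> its
  first row, so \<open>det_one\<close> is \<open>det A = 1\<close>. The power of \<open>q\<close> is
  taken at the target exponent because in \<open>x^p y^d\<close> the factor \<open>y^d\<close>
  shifts first.\<close>

locale qplane_laurent_module = qplane_module q M
  for q and M :: "(qtorus_elt, laurent, 'd) module_scheme" +
  fixes d1 d2 p1 p2 :: int and C1 C2 :: complex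
  assumes gen: "generic q"
    and carrier_eq [simp]: "carrier M = UNIV"
    and add_eq [simp]: "f \<oplus>\<^bsub>M\<^esub> g = f + g"
    and zero_eq [simp]: "\<zero>\<^bsub>M\<^esub> = 0"
    and const_smult: "qconst q c \<odot>\<^bsub>M\<^esub> f = Poly_Mapping.single 0 c * f"
    and x_single:
      "qx q \<odot>\<^bsub>M\<^esub> Poly_Mapping.single n c = Poly_Mapping.single (n + d1) (C1 * q powi (p1 * (n + d1)) * c)"
    and y_single:
      "qy q \<odot>\<^bsub>M\<^esub> Poly_Mapping.single n c = Poly_Mapping.single (n + d2) (C2 * q powi (p2 * (n + d2)) * c)"
    and C_nz: "C1 \<noteq> 0" "C2 \<noteq> 0"
    and det_one: "p1 * d2 - p2 * d1 = 1"
begin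

lemma q_nz [simp]: "q \<noteq> 0"
  using gen by (simp add: generic_def)

lemma q_powi_eq_iff: "q powi m = q powi n \<longleftrightarrow> m = n"
proof
  \<comment> \<open>As \<open>generic\<close> speaks of positive natural exponents only, the smaller
    of two different exponents is divided out; the other order follows by symmetry.\<close>
  have *: False if "m < n" "q powi m = q powi n" for m n
  proof -
    have "q powi (n - m) = 1" using that by (simp add: power_int_diff)
    moreover have "q powi (n - m) = q ^ nat (n - m)"
      using that(1) by (simp add: power_int_def)
    ultimately show False
      using gen that(1) by (auto simp: generic_def)
  qed
  assume "q powi m = q powi n"
  then show "m = n" using *[of m n] *[of n m] by (cases m n rule: linorder_cases) auto
qed simp

lemma const_single:
  "qconst q c \<odot>\<^bsub>M\<^esub> Poly_Mapping.single n d = Poly_Mapping.single n (c * d)"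
  by (simp add: const_smult mult_single)

lemma lookup_const: "Poly_Mapping.lookup (qconst q c \<odot>\<^bsub>M\<^esub> f) k = c * Poly_Mapping.lookup f k"
proof (induction f rule: poly_mapping_single_add_induct)
  case (single n d)
  then show ?case by (simp add: const_single lookup_single when_def)
next
  case (add f g)
  then show ?case
    using smult_r_distr[of "qconst q c" f g] by (simp add: lookup_add algebra_simps)
qed

text \<open>The coefficientwise form makes supports visible. Both sides are additive in
  \<open>f\<close>, so monomials suffice.\<close>

lemma lookup_x:
  "Poly_Mapping.lookup (qx q \<odot>\<^bsub>M\<^esub> f) k = C1 * q powi (p1 * k) * Poly_Mapping.lookup f (k - d1)"
proof (induction f rule: poly_mapping_single_add_induct)
  case (single n d)
  then show ?case by (auto simp: x_single lookup_single when_def)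
next
  case (add f g)
  then show ?case
    using smult_r_distr[of "qx q" f g] by (simp add: lookup_add algebra_simps)
qed

lemma lookup_y:
  "Poly_Mapping.lookup (qy q \<odot>\<^bsub>M\<^esub> f) k = C2 * q powi (p2 * k) * Poly_Mapping.lookup f (k - d2)"
proof (induction f rule: poly_mapping_single_add_induct)
  case (single n d)
  then show ?case by (auto simp: y_single lookup_single when_def)
next
  case (add f g)
  then show ?case
    using smult_r_distr[of "qy q" f g] by (simp add: lookup_add algebra_simps)
qed

section \<open>Steps that do not have opposite signs\<close>

lemma not_simple:
  assumes "\<not> d1 * d2 < 0"
  shows "\<not> simple_module (qplane q) M"
proof
  assume simple: "simple_module (qplane q) M"
  have "(0 \<le> d1 \<and> 0 \<le> d2) \<or> (d1 \<le> 0 \<and> d2 \<le> 0)"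
    using assms by (auto simp: mult_less_0_iff not_less)
  \<comment> \<open>The sign \<open>e\<close> is a direction in which neither step goes backwards;
    the Laurent polynomials supported on the half-line in that direction form
    \<open>H\<close>.\<close>
  then obtain e :: int where e: "e \<noteq> 0" "0 \<le> e * d1" "0 \<le> e * d2"
    using that[of 1] that[of "-1"] by auto
  define H :: "laurent set" where "H = {f. \<forall>k. Poly_Mapping.lookup f k \<noteq> 0 \<longrightarrow> 0 \<le> e * k}"
  have "submodule H (qplane q) M"
  proof (rule submoduleI)
    show "v \<oplus>\<^bsub>M\<^esub> w \<in> H" if "v \<in> H" "w \<in> H" for v w
    proof -
      have "Poly_Mapping.lookup v k \<noteq> 0 \<or> Poly_Mapping.lookup w k \<noteq> 0"
        if "Poly_Mapping.lookup (v + w) k \<noteq> 0" for k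
        using that by (auto simp: lookup_add)
      then show ?thesis using that by (auto simp: H_def)
    qed
    show "qx q \<odot>\<^bsub>M\<^esub> v \<in> H" if "v \<in> H" for v
      unfolding H_def
    proof (intro CollectI allI impI)
      fix k assume "Poly_Mapping.lookup (qx q \<odot>\<^bsub>M\<^esub> v) k \<noteq> 0"
      then have "0 \<le> e * (k - d1)" using that by (simp add: lookup_x H_def)
      then show "0 \<le> e * k" using e by (simp add: algebra_simps)
    qed
    show "qy q \<odot>\<^bsub>M\<^esub> v \<in> H" if "v \<in> H" for v
      unfolding H_def
    proof (intro CollectI allI impI)
      fix k assume "Poly_Mapping.lookup (qy q \<odot>\<^bsub>M\<^esub> v) k \<noteq> 0"
      then have "0 \<le> e * (k - d2)" using that by (simp add: lookup_y H_def)
      then show "0 \<le> e * k" using e by (simp add: algebra_simps)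
    qed
  qed (auto simp: H_def lookup_const)
  then have "H = {0} \<or> H = UNIV"
    using simple by (auto simp: simple_module_def)
  \<comment> \<open>The power \<open>t^0\<close> shows that \<open>H\<close> is nonzero, and
    \<open>t^(-e)\<close> that it is not everything.\<close>
  moreover have "Poly_Mapping.single 0 1 \<in> H"
    by (auto simp: H_def lookup_one when_def)
  moreover have "Poly_Mapping.single (-e) 1 \<notin> H"
  proof
    assume "Poly_Mapping.single (-e) 1 \<in> H"
    then have "0 \<le> e * (-e)"
      unfolding H_def mem_Collect_eq by (metis lookup_single_eq zero_neq_one)
    then show False using e(1) by (auto simp: mult_le_0_iff)
  qed
  ultimately show False
    using single_one_nz[of "0::int", where 'b = complex] by blast
qed

section \<open>Action of monomials on the powers of \<open>t\<close>\<close>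

lemma x_pow_single:
  "\<exists>m. \<forall>n c. ((\<odot>\<^bsub>M\<^esub>) (qx q) ^^ i) (Poly_Mapping.single n c) =
    Poly_Mapping.single (n + int i * d1) (C1 ^ i * q powi (int i * p1 * n + m) * c)"
proof (induction i)
  case 0
  show ?case by (auto intro: exI[of _ 0])
next
  case (Suc i)
  then obtain m where m: "\<And>n c. ((\<odot>\<^bsub>M\<^esub>) (qx q) ^^ i) (Poly_Mapping.single n c) =
    Poly_Mapping.single (n + int i * d1) (C1 ^ i * q powi (int i * p1 * n + m) * c)" by blast
  \<comment> \<open>The new weight is taken at exponent \<open>n + int (Suc i) * d1\<close>; the
    part of it without \<open>n\<close> is absorbed into the offset. Only the coefficient of
    \<open>n\<close> and the independence of \<open>m\<close> from \<open>n\<close> and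
    \<open>c\<close> matter later.\<close>
  have "((\<odot>\<^bsub>M\<^esub>) (qx q) ^^ Suc i) (Poly_Mapping.single n c) =
    Poly_Mapping.single (n + int (Suc i) * d1)
      (C1 ^ Suc i * q powi (int (Suc i) * p1 * n + (m + p1 * d1 * int (Suc i))) * c)" for n c
    by (simp add: m x_single power_int_add algebra_simps)
  then show ?case by blast
qed

lemma y_pow_single:
  "\<exists>m. \<forall>n c. ((\<odot>\<^bsub>M\<^esub>) (qy q) ^^ i) (Poly_Mapping.single n c) =
    Poly_Mapping.single (n + int i * d2) (C2 ^ i * q powi (int i * p2 * n + m) * c)"
proof (induction i)
  case 0
  show ?case by (auto intro: exI[of _ 0])
next
  case (Suc i)
  then obtain m where m: "\<And>n c. ((\<odot>\<^bsub>M\<^esub>) (qy q) ^^ i) (Poly_Mapping.single n c) =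
    Poly_Mapping.single (n + int i * d2) (C2 ^ i * q powi (int i * p2 * n + m) * c)" by blast
  have "((\<odot>\<^bsub>M\<^esub>) (qy q) ^^ Suc i) (Poly_Mapping.single n c) =
    Poly_Mapping.single (n + int (Suc i) * d2)
      (C2 ^ Suc i * q powi (int (Suc i) * p2 * n + (m + p2 * d2 * int (Suc i))) * c)" for n c
    by (simp add: m y_single power_int_add algebra_simps)
  then show ?case by blast
qed

lemma monom_act_single:
  "\<exists>m. \<forall>n c. monom_act i j (Poly_Mapping.single n c) =
    Poly_Mapping.single (n + int i * d1 + int j * d2)
      (C1 ^ i * C2 ^ j * q powi ((int i * p1 + int j * p2) * n + m) * c)"
proof -
  obtain m1 m2 where m: "\<And>n c. ((\<odot>\<^bsub>M\<^esub>) (qx q) ^^ i) (Poly_Mapping.single n c) =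
      Poly_Mapping.single (n + int i * d1) (C1 ^ i * q powi (int i * p1 * n + m1) * c)"
    "\<And>n c. ((\<odot>\<^bsub>M\<^esub>) (qy q) ^^ j) (Poly_Mapping.single n c) =
      Poly_Mapping.single (n + int j * d2) (C2 ^ j * q powi (int j * p2 * n + m2) * c)"
    using x_pow_single[of i] y_pow_single[of j] by blast
  \<comment> \<open>The cross term \<open>int i * p1 * int j * d2\<close> arises because the
    \<open>x\<close> factors meet an exponent already moved by \<open>int j * d2\<close>.\<close>
  have "monom_act i j (Poly_Mapping.single n c) =
    Poly_Mapping.single (n + int i * d1 + int j * d2)
      (C1 ^ i * C2 ^ j * q powi ((int i * p1 + int j * p2) * n + (m1 + m2 + int i * p1 * int j * d2)) * c)"
    for n c
    by (simp add: monom_act_def m power_int_add algebra_simps)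
  then show ?thesis by blast
qed

lemma monom_act_single_nz:
  obtains \<gamma> where "\<gamma> \<noteq> 0"
    "monom_act i j (Poly_Mapping.single n 1) = Poly_Mapping.single (n + int i * d1 + int j * d2) \<gamma>"
proof -
  obtain m where "monom_act i j (Poly_Mapping.single n 1) =
    Poly_Mapping.single (n + int i * d1 + int j * d2)
      (C1 ^ i * C2 ^ j * q powi ((int i * p1 + int j * p2) * n + m) * 1)"
    using monom_act_single[of i j] by blast
  then show thesis using C_nz by (intro that) auto
qed

lemma monom_act_mem:
  assumes "submodule H (qplane q) M" "v \<in> H"
  shows "monom_act i j v \<in> H"
proof -
  note D = submoduleD(4)[OF assms(1)]
  have y: "((\<odot>\<^bsub>M\<^esub>) (qy q) ^^ j) v \<in> H" by (induction j) (auto intro: D assms(2))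
  show ?thesis unfolding monom_act_def by (induction i) (auto intro: D y)
qed

section \<open>Steps of opposite sign: the eigenvalues of \<open>K\<close> and simplicity\<close>

context
  fixes a b :: nat and \<epsilon> :: int
  assumes neg: "d1 * d2 < 0"
    and a_def: "a = nat \<bar>d2\<bar>" and b_def: "b = nat \<bar>d1\<bar>" and eps_def: "\<epsilon> = sgn d2"
begin

text \<open>Since the signs are opposite, \<open>d1\<close> has sign \<open>-\<epsilon>\<close>; the
  absolute values thus become linear expressions in the steps.\<close>

lemma ab_eq: "int a = \<epsilon> * d2" "int b = - \<epsilon> * d1" "a > 0" "b > 0" "\<epsilon> = 1 \<or> \<epsilon> = -1"
  using neg by (auto simp: a_def b_def eps_def sgn_if mult_less_0_iff)

lemma d_eq: "d2 = \<epsilon> * int a" "d1 = - \<epsilon> * int b"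
  using ab_eq by auto

text \<open>Up to the sign \<open>\<epsilon>\<close>, the determinant condition is a Bezout identity
  for \<open>a\<close> and \<open>b\<close>.\<close>

lemma coprime_ab: "coprime a b"
proof -
  have "\<epsilon> * (p1 * int a + p2 * int b) = 1"
    using det_one d_eq by (simp add: algebra_simps)
  then have "p1 * int a + p2 * int b = \<epsilon>"
    using ab_eq(5) by auto
  moreover have "is_unit \<epsilon>" using ab_eq(5) by auto
  ultimately have *: "is_unit (p1 * int a + p2 * int b)" by simp
  have "coprime (int a) (int b)"
  proof (rule coprimeI)
    fix d assume "d dvd int a" "d dvd int b"
    then have "d dvd p1 * int a + p2 * int b" by (intro dvd_add dvd_mult)
    then show "is_unit d" using * dvd_trans by blast
  qed
  then show ?thesis by simp
qed

text \<open>The determinant gives the integer solution \<open>(- k * p2, k * p1)\<close>. Adding a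
  multiple of \<open>(a, b)\<close>, whose total shift is 0, makes both coordinates
  nonnegative.\<close>

lemma reach: "\<exists>i j :: nat. k = int i * d1 + int j * d2"
proof -
  \<comment> \<open>As \<open>a\<close> and \<open>b\<close> are at least 1, adding \<open>s\<close>
    times each outweighs either possibly negative coordinate.\<close>
  define s where "s = \<bar>k * p1\<bar> + \<bar>k * p2\<bar>"
  have "1 * s \<le> int a * s" "1 * s \<le> int b * s"
    using ab_eq(3,4) by (intro mult_right_mono; simp add: s_def)+
  moreover have "\<bar>k * p1\<bar> \<le> s" "\<bar>k * p2\<bar> \<le> s" by (simp_all add: s_def)
  ultimately have pos: "0 \<le> - k * p2 + int a * s" "0 \<le> k * p1 + int b * s"
    by linarith+
  have "(- k * p2 + int a * s) * d1 + (k * p1 + int b * s) * d2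
      = k * (p1 * d2 - p2 * d1) + s * (int a * d1 + int b * d2)"
    by (simp add: algebra_simps)
  also have "\<dots> = k"
    using det_one ab_eq(1,2) by (simp add: algebra_simps)
  finally show ?thesis
    using pos by (metis nat_0_le)
qed

text \<open>Reading the eigenvalue of \<open>K\<close> on \<open>t^n\<close> off as a coefficient
  avoids naming the offset in its exponent.\<close>

definition eigval :: "int \<Rightarrow> complex" where
  "eigval n = Poly_Mapping.lookup (monom_act a b (Poly_Mapping.single n 1)) n"

text \<open>The shifts of \<open>x^a\<close> and \<open>y^b\<close> cancel, so each power of
  \<open>t\<close> spans an eigenline, while the weights combine to \<open>\<epsilon>\<close> times
  the determinant, which makes \<open>\<epsilon>\<close> the coefficient of
  \<open>n\<close>.\<close>

lemma eigval:
  "\<exists>m. \<forall>n. eigval n = C1 ^ a * C2 ^ b * q powi (\<epsilon> * n + m) \<and>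
    (\<forall>c. monom_act a b (Poly_Mapping.single n c) = Poly_Mapping.single n (eigval n * c))"
proof -
  have 1: "int a * d1 + int b * d2 = 0" using ab_eq(1,2) by (simp add: algebra_simps)
  have "int a * p1 + int b * p2 = \<epsilon> * (p1 * d2 - p2 * d1)"
    using ab_eq(1,2) by (simp add: algebra_simps)
  then have 2: "int a * p1 + int b * p2 = \<epsilon>" by (simp add: det_one)
  obtain m where "\<forall>n c. monom_act a b (Poly_Mapping.single n c) =
      Poly_Mapping.single (n + int a * d1 + int b * d2)
        (C1 ^ a * C2 ^ b * q powi ((int a * p1 + int b * p2) * n + m) * c)"
    using monom_act_single[of a b] by blast
  then have "monom_act a b (Poly_Mapping.single n c) =
    Poly_Mapping.single n (C1 ^ a * C2 ^ b * q powi (\<epsilon> * n + m) * c)" for n c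
    by (simp only: 1 2 add.assoc add_0_right)
  then show ?thesis by (auto simp: eigval_def intro!: exI[of _ m])
qed

lemma eigval_eq: "\<exists>m. \<forall>n. eigval n = C1 ^ a * C2 ^ b * q powi (\<epsilon> * n + m)"
  using eigval by meson

lemma monom_act_eigval:
  "monom_act a b (Poly_Mapping.single n c) = Poly_Mapping.single n (eigval n * c)"
  using eigval by meson

lemma eigval_inj: "eigval m = eigval n \<longleftrightarrow> m = n"
proof -
  obtain r where "\<forall>n. eigval n = C1 ^ a * C2 ^ b * q powi (\<epsilon> * n + r)"
    using eigval_eq ..
  then have "eigval m = eigval n \<longleftrightarrow> \<epsilon> * m + r = \<epsilon> * n + r"
    using C_nz by (simp add: q_powi_eq_iff)
  also have "\<dots> \<longleftrightarrow> m = n" using ab_eq(5) by auto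
  finally show ?thesis .
qed

text \<open>As \<open>\<epsilon>\<close> is 1 or -1, \<open>\<epsilon> * n + r\<close> runs through
  all integers. Every representative of the coset is therefore the eigenvalue of some
  \<open>t^n\<close>.\<close>

lemma eigval_class: "range eigval = qZ_class q (C1 ^ a * C2 ^ b)"
proof -
  obtain r where r: "\<forall>n. eigval n = C1 ^ a * C2 ^ b * q powi (\<epsilon> * n + r)"
    using eigval_eq ..
  have "\<epsilon> * (\<epsilon> * (m - r)) + r = m" for m
    using ab_eq(5) by (elim disjE) simp_all
  then have *: "C1 ^ a * C2 ^ b * q powi m = eigval (\<epsilon> * (m - r))" for m
    by (simp only: r)
  show ?thesis
  proof (intro equalityI subsetI)
    fix l assume "l \<in> range eigval"
    then show "l \<in> qZ_class q (C1 ^ a * C2 ^ b)"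
      unfolding qZ_class_def using r by blast
  next
    fix l assume "l \<in> qZ_class q (C1 ^ a * C2 ^ b)"
    then obtain m where "l = C1 ^ a * C2 ^ b * q powi m"
      unfolding qZ_class_def by blast
    then show "l \<in> range eigval"
      using * by blast
  qed
qed

lemma qK_single: "qK q a b \<odot>\<^bsub>M\<^esub> Poly_Mapping.single n c = qconst q (eigval n) \<odot>\<^bsub>M\<^esub> Poly_Mapping.single n c"
  by (simp add: qK_smult const_single monom_act_eigval)

lemma qK_mem: "qK q a b \<in> carrier (qplane q)"
proof -
  interpret P: ring "qplane q" by (rule ring_qplane)
  have "qK q a b = qx q [^]\<^bsub>qplane q\<^esub> a \<otimes>\<^bsub>qplane q\<^esub> qy q [^]\<^bsub>qplane q\<^esub> b"
    by (simp add: qK_def qplane_nat_pow qplane_simps(2-5))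
  then show ?thesis by simp
qed

lemma lookup_qK:
  "Poly_Mapping.lookup (qK q a b \<odot>\<^bsub>M\<^esub> f) k = eigval k * Poly_Mapping.lookup f k"
proof (induction f rule: poly_mapping_single_add_induct)
  case (single n c)
  then show ?case by (simp add: qK_single const_single lookup_single when_def)
next
  case (add f g)
  then show ?case
    using smult_r_distr[OF qK_mem, of f g] by (simp add: lookup_add algebra_simps)
qed

text \<open>The eigenvalues of \<open>K\<close> on the powers of \<open>t\<close> are distinct, so \<open>K\<close> minus one of them
  shortens an element of minimal support.\<close>

lemma submodule_contains_single:
  assumes H: "submodule H (qplane q) M" and "f \<in> H" "f \<noteq> 0"
  shows "\<exists>k. Poly_Mapping.single k 1 \<in> H"
  using assms(2,3)
proof (induction "card (Poly_Mapping.keys f)" arbitrary: f rule: less_induct)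
  case less
  obtain k where k: "k \<in> Poly_Mapping.keys f" using less.prems(2) by (meson keys_eq_empty ex_in_conv)
  show ?case
  proof (cases "Poly_Mapping.keys f = {k}")
    case True
    then have "f = Poly_Mapping.single k (Poly_Mapping.lookup f k)"
      by (intro poly_mapping_eqI) (auto simp: lookup_single when_def in_keys_iff)
    then have "Poly_Mapping.single k 1 = qconst q (1 / Poly_Mapping.lookup f k) \<odot>\<^bsub>M\<^esub> f"
      using k by (metis const_single in_keys_iff nonzero_divide_eq_eq)
    then show ?thesis using submoduleD(4)[OF H] less.prems(1) by (metis qplane_gen(1))
  next
    case False
    define g where "g = qK q a b \<odot>\<^bsub>M\<^esub> f \<oplus>\<^bsub>M\<^esub> qconst q (- eigval k) \<odot>\<^bsub>M\<^esub> f"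
    have "g \<in> H"
      unfolding g_def using less.prems(1)
      by (intro submoduleD(3)[OF H] submoduleD(4)[OF H] qK_mem qplane_gen)
    moreover have "Poly_Mapping.lookup g n = (eigval n - eigval k) * Poly_Mapping.lookup f n" for n
      by (simp add: g_def lookup_add lookup_qK lookup_const algebra_simps)
    then have keys: "Poly_Mapping.keys g = Poly_Mapping.keys f - {k}"
      by (auto simp: in_keys_iff eigval_inj)
    then have "card (Poly_Mapping.keys g) < card (Poly_Mapping.keys f)"
      using k by (simp only: keys card_Diff1_less finite_keys)
    moreover have "g \<noteq> 0"
    proof -
      obtain n where "n \<in> Poly_Mapping.keys f - {k}" using False k by blast
      then have "n \<in> Poly_Mapping.keys g" by (simp only: keys)
      then show ?thesis by (metis keys_zero empty_iff)
    qed
    ultimately show ?thesis using less.hyps by blast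
  qed
qed

lemma simple: "simple_module (qplane q) M"
  unfolding simple_module_def
proof (intro conjI allI impI)
  show "left_module (qplane q) M" by (rule left_module_axioms)
  show "carrier M \<noteq> {\<zero>\<^bsub>M\<^esub>}"
    using single_one_nz[of "0::int", where 'b = complex] by (metis UNIV_I carrier_eq singletonD zero_eq)
  fix H assume H: "submodule H (qplane q) M"
  show "H = {\<zero>\<^bsub>M\<^esub>} \<or> H = carrier M"
  proof (cases "\<exists>f\<in>H. f \<noteq> 0")
    case True
    then obtain n where n: "Poly_Mapping.single n 1 \<in> H"
      using submodule_contains_single[OF H] by blast
    have single: "Poly_Mapping.single k c \<in> H" for k c
    proof -
      obtain i j where ij: "k - n = int i * d1 + int j * d2" using reach by blast
      obtain \<gamma> where g: "\<gamma> \<noteq> 0"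
        "monom_act i j (Poly_Mapping.single n 1) = Poly_Mapping.single (n + int i * d1 + int j * d2) \<gamma>"
        by (rule monom_act_single_nz)
      have kn: "n + int i * d1 + int j * d2 = k" using ij by simp
      have "qconst q (c / \<gamma>) \<odot>\<^bsub>M\<^esub> monom_act i j (Poly_Mapping.single n 1) = Poly_Mapping.single k c"
        using g(1) by (simp add: g(2) const_single kn)
      then show ?thesis
        using submoduleD(4)[OF H qplane_gen(1) monom_act_mem[OF H n]] by metis
    qed
    have "f \<in> H" for f
      by (induction f rule: poly_mapping_single_add_induct) (use single submoduleD(3)[OF H] in auto)
    then show ?thesis by auto
  next
    case False
    then show ?thesis using submoduleD(2)[OF H] by auto
  qed
qed

section \<open>Comparison with an arbitrary simple module containing an eigenvector of
  \<open>K\<close>\<close>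

lemma same_weight_shift:
  assumes eq: "int i * d1 + int j * d2 = int i' * d1 + int j' * d2" and le: "i \<le> i'"
  shows "\<exists>s. i' = i + s * a \<and> j' = j + s * b"
proof -
  obtain r where r: "i' = i + r" using le le_Suc_ex by blast
  \<comment> \<open>The difference of the exponent pairs has total shift 0. With \<open>a\<close>
    and \<open>b\<close> coprime this forces it to be a multiple of \<open>(a, b)\<close>, and
    \<open>i \<le> i'\<close> makes the multiple a natural number.\<close>
  have "\<epsilon> * (int r * int b) = \<epsilon> * ((int j' - int j) * int a)"
    using eq unfolding d_eq r by (simp add: algebra_simps)
  then have rb: "int r * int b = (int j' - int j) * int a"
    using ab_eq(5) by auto
  then have "int a dvd int r * int b" by simp
  then have "a dvd r"
    using coprime_ab by (metis coprime_dvd_mult_left_iff int_dvd_int_iff of_nat_mult)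
  then obtain s where s: "r = a * s" by blast
  then have "int a * (int s * int b) = int a * (int j' - int j)"
    using rb by (simp add: algebra_simps)
  then have "int j' = int (j + s * b)"
    using ab_eq(3) by simp
  then show ?thesis using r s by (metis mult.commute of_nat_eq_iff)
qed

lemma monom_act_single_ex:
  "\<exists>i j \<gamma>. \<gamma> \<noteq> 0 \<and> monom_act i j (Poly_Mapping.single n 1) = Poly_Mapping.single k \<gamma>"
proof -
  obtain i j where ij: "k - n = int i * d1 + int j * d2" using reach by blast
  obtain \<gamma> where "\<gamma> \<noteq> 0"
    "monom_act i j (Poly_Mapping.single n 1) = Poly_Mapping.single (n + int i * d1 + int j * d2) \<gamma>"
    by (rule monom_act_single_nz)
  moreover have "n + int i * d1 + int j * d2 = k" using ij by simp
  ultimately show ?thesis by auto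
qed

text \<open>Two monomials sending \<open>t\<^sup>n\<close> to the same power of \<open>t\<close> differ by a power of \<open>K\<close>, hence their
  actions on an eigenvector of \<open>K\<close> in any other module have the same ratio.\<close>

lemma monom_act_ratio:
  assumes N: "qplane_module q N" and v: "v \<in> carrier N"
    and K: "qK q a b \<odot>\<^bsub>N\<^esub> v = qconst q (eigval n) \<odot>\<^bsub>N\<^esub> v"
    and nz: "\<gamma> \<noteq> 0" "\<gamma>' \<noteq> 0"
    and m: "monom_act i j (Poly_Mapping.single n 1) = Poly_Mapping.single k \<gamma>"
    and m': "monom_act i' j' (Poly_Mapping.single n 1) = Poly_Mapping.single k \<gamma>'"
    and le: "i \<le> i'"
  shows "qplane_module.monom_act q N i' j' v =
    qconst q (\<gamma>' / \<gamma>) \<odot>\<^bsub>N\<^esub> qplane_module.monom_act q N i j v"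
proof -
  interpret N: qplane_module q N by fact
  \<comment> \<open>A nonzero coefficient determines the exponent of a monomial.\<close>
  have weight: "n + int i * d1 + int j * d2 = k"
    if "\<gamma> \<noteq> 0" "monom_act i j (Poly_Mapping.single n 1) = Poly_Mapping.single k \<gamma>" for i j \<gamma>
  proof -
    obtain \<delta> where "\<delta> \<noteq> 0"
      "monom_act i j (Poly_Mapping.single n 1) = Poly_Mapping.single (n + int i * d1 + int j * d2) \<delta>"
      by (rule monom_act_single_nz)
    then show ?thesis using that by (metis lookup_single_eq lookup_single_not_eq)
  qed
  have "int i * d1 + int j * d2 = int i' * d1 + int j' * d2"
    using weight[OF nz(1) m] weight[OF nz(2) m'] by linarith
  then obtain s where s: "i' = i + s * a" "j' = j + s * b"
    using same_weight_shift[OF _ le] by blast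
  \<comment> \<open>This is the factor from \<open>monom_act_shift\<close>, common to both modules.
    Its value is found in \<open>M\<close>, where coefficients can be compared, and then used in
    \<open>N\<close>.\<close>
  define \<kappa> where "\<kappa> = (\<Prod>r<s. eigval n * q ^ (a * (j + r * b)))"
  have "monom_act a b (Poly_Mapping.single n 1) = qconst q (eigval n) \<odot>\<^bsub>M\<^esub> Poly_Mapping.single n 1"
    by (simp add: monom_act_eigval const_single)
  then have "monom_act i' j' (Poly_Mapping.single n 1) =
      qconst q \<kappa> \<odot>\<^bsub>M\<^esub> monom_act i j (Poly_Mapping.single n 1)"
    unfolding s \<kappa>_def by (intro monom_act_shift) auto
  then have "\<gamma>' = \<kappa> * \<gamma>"
    unfolding m m' const_single by (metis lookup_single_eq)
  then have "\<kappa> = \<gamma>' / \<gamma>" using nz by simp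
  moreover have "N.monom_act a b v = qconst q (eigval n) \<odot>\<^bsub>N\<^esub> v"
    using K v by (simp add: N.qK_smult)
  then have "N.monom_act i' j' v = qconst q \<kappa> \<odot>\<^bsub>N\<^esub> N.monom_act i j v"
    unfolding s \<kappa>_def using v by (intro N.monom_act_shift)
  ultimately show ?thesis by simp
qed

text \<open>The vector \<open>w k\<close> is the intended image of \<open>t^k\<close>. It is built
  from one chosen monomial that leads from \<open>t^n\<close> to \<open>t^k\<close>, and
  \<open>monom_act_ratio\<close> shows that every other such monomial gives the same vector.\<close>

lemma weight_vectors_ex:
  assumes N: "qplane_module q N" and v: "v \<in> carrier N"
    and K: "qK q a b \<odot>\<^bsub>N\<^esub> v = qconst q (eigval n) \<odot>\<^bsub>N\<^esub> v"
  shows "\<exists>w. \<forall>k. w k \<in> carrier N \<and> (\<forall>i j \<gamma>. \<gamma> \<noteq> 0 \<longrightarrow>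
    monom_act i j (Poly_Mapping.single n 1) = Poly_Mapping.single k \<gamma> \<longrightarrow>
    qplane_module.monom_act q N i j v = qconst q \<gamma> \<odot>\<^bsub>N\<^esub> w k)"
proof (rule choice, rule allI)
  fix k
  interpret N: qplane_module q N by fact
  obtain i0 j0 \<gamma>0 where 0: "\<gamma>0 \<noteq> 0"
    "monom_act i0 j0 (Poly_Mapping.single n 1) = Poly_Mapping.single k \<gamma>0"
    using monom_act_single_ex by blast
  let ?w = "qconst q (1 / \<gamma>0) \<odot>\<^bsub>N\<^esub> N.monom_act i0 j0 v"
  have "N.monom_act i j v = qconst q \<gamma> \<odot>\<^bsub>N\<^esub> ?w"
    if ij: "\<gamma> \<noteq> 0" "monom_act i j (Poly_Mapping.single n 1) = Poly_Mapping.single k \<gamma>" for i j \<gamma>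
  proof -
    have "N.monom_act i j v = qconst q (\<gamma> / \<gamma>0) \<odot>\<^bsub>N\<^esub> N.monom_act i0 j0 v"
    proof (cases "i0 \<le> i")
      case True
      show ?thesis by (rule monom_act_ratio[OF N v K 0(1) ij(1) 0(2) ij(2) True])
    next
      case False
      \<comment> \<open>Here the chosen monomial has the larger power of \<open>x\<close>, so the
        ratio is obtained with the roles exchanged and then inverted.\<close>
      then have "N.monom_act i0 j0 v = qconst q (\<gamma>0 / \<gamma>) \<odot>\<^bsub>N\<^esub> N.monom_act i j v"
        by (intro monom_act_ratio[OF N v K ij(1) 0(1) ij(2) 0(2)]) simp
      then show ?thesis
        using v 0(1) ij(1) by (simp add: N.const_smult_const)
    qed
    then show ?thesis using v by (simp add: N.const_smult_const)
  qed
  then show "\<exists>w. w \<in> carrier N \<and> (\<forall>i j \<gamma>. \<gamma> \<noteq> 0 \<longrightarrow>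
      monom_act i j (Poly_Mapping.single n 1) = Poly_Mapping.single k \<gamma> \<longrightarrow>
      N.monom_act i j v = qconst q \<gamma> \<odot>\<^bsub>N\<^esub> w)"
    using v by (intro exI[of _ ?w]) auto
qed

text \<open>The linear extension of \<open>t^k \<mapsto> w k\<close> commutes with \<open>x\<close>
  and \<open>y\<close> and sends \<open>t^n\<close> to the nonzero vector \<open>v\<close>, so it is
  an isomorphism of simple modules.\<close>

lemma isomorphic:
  assumes simple_N: "simple_module (qplane q) N" and v: "v \<in> carrier N" "v \<noteq> \<zero>\<^bsub>N\<^esub>"
    and K: "qK q a b \<odot>\<^bsub>N\<^esub> v = qconst q (eigval n) \<odot>\<^bsub>N\<^esub> v"
  shows "module_isomorphic (qplane q) M N"
proof -
  interpret N: qplane_module q N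
    using simple_N by (simp add: qplane_module_def simple_module_def)
  obtain w where w: "\<And>k. w k \<in> carrier N"
    and monom_w: "\<And>i j k \<gamma>. \<gamma> \<noteq> 0 \<Longrightarrow>
      monom_act i j (Poly_Mapping.single n 1) = Poly_Mapping.single k \<gamma> \<Longrightarrow>
      N.monom_act i j v = qconst q \<gamma> \<odot>\<^bsub>N\<^esub> w k"
    using weight_vectors_ex[OF N.qplane_module_axioms v(1) K] by blast
  have cancel: "u = u'" if "qconst q c \<odot>\<^bsub>N\<^esub> u = qconst q c \<odot>\<^bsub>N\<^esub> u'" "c \<noteq> 0"
    "u \<in> carrier N" "u' \<in> carrier N" for c u u'
  proof -
    have "qconst q (1 / c) \<odot>\<^bsub>N\<^esub> (qconst q c \<odot>\<^bsub>N\<^esub> u) = qconst q (1 / c) \<odot>\<^bsub>N\<^esub> (qconst q c \<odot>\<^bsub>N\<^esub> u')"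
      by (simp only: that(1))
    then show ?thesis using that(2-4) by (simp add: N.const_smult_const)
  qed
  \<comment> \<open>A monomial leading to \<open>t^k\<close> is prolonged by one \<open>x\<close>.
    Evaluating it on \<open>v\<close> through \<open>w (k + d1)\<close> and through
    \<open>w k\<close>, then cancelling \<open>\<gamma>\<close>, gives the relation.\<close>
  have x_w: "qx q \<odot>\<^bsub>N\<^esub> w k = qconst q (C1 * q powi (p1 * (k + d1))) \<odot>\<^bsub>N\<^esub> w (k + d1)" for k
  proof -
    obtain i j \<gamma> where ij: "\<gamma> \<noteq> 0"
      "monom_act i j (Poly_Mapping.single n 1) = Poly_Mapping.single k \<gamma>"
      using monom_act_single_ex by blast
    have "monom_act (Suc i) j (Poly_Mapping.single n 1) =
      Poly_Mapping.single (k + d1) (C1 * q powi (p1 * (k + d1)) * \<gamma>)"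
      by (simp add: x_monom_act[symmetric] ij(2) x_single)
    then have "N.monom_act (Suc i) j v =
      qconst q (C1 * q powi (p1 * (k + d1)) * \<gamma>) \<odot>\<^bsub>N\<^esub> w (k + d1)"
      using C_nz ij(1) by (intro monom_w) auto
    moreover have "N.monom_act (Suc i) j v = qconst q \<gamma> \<odot>\<^bsub>N\<^esub> (qx q \<odot>\<^bsub>N\<^esub> w k)"
      using w by (simp add: N.x_monom_act[symmetric] monom_w[OF ij] N.x_smult_const)
    ultimately have "qconst q \<gamma> \<odot>\<^bsub>N\<^esub> (qx q \<odot>\<^bsub>N\<^esub> w k) =
      qconst q \<gamma> \<odot>\<^bsub>N\<^esub> (qconst q (C1 * q powi (p1 * (k + d1))) \<odot>\<^bsub>N\<^esub> w (k + d1))"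
      using w by (simp add: N.const_smult_const mult.commute)
    then show ?thesis by (rule cancel) (use ij(1) w in simp_all)
  qed
  \<comment> \<open>The same argument with one more \<open>y\<close>; the factor
    \<open>q ^ i\<close> from moving it past \<open>x^i\<close> occurs in both evaluations and
    cancels.\<close>
  have y_w: "qy q \<odot>\<^bsub>N\<^esub> w k = qconst q (C2 * q powi (p2 * (k + d2))) \<odot>\<^bsub>N\<^esub> w (k + d2)" for k
  proof -
    obtain i j \<gamma> where ij: "\<gamma> \<noteq> 0"
      "monom_act i j (Poly_Mapping.single n 1) = Poly_Mapping.single k \<gamma>"
      using monom_act_single_ex by blast
    have "monom_act i (Suc j) (Poly_Mapping.single n 1) =
      Poly_Mapping.single (k + d2) (q ^ i * (C2 * q powi (p2 * (k + d2)) * \<gamma>))"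
      by (simp add: y_monom_act ij(2) y_single const_single)
    then have "N.monom_act i (Suc j) v =
      qconst q (q ^ i * (C2 * q powi (p2 * (k + d2)) * \<gamma>)) \<odot>\<^bsub>N\<^esub> w (k + d2)"
      using C_nz ij(1) by (intro monom_w) auto
    moreover have "N.monom_act i (Suc j) v = qconst q (q ^ i * \<gamma>) \<odot>\<^bsub>N\<^esub> (qy q \<odot>\<^bsub>N\<^esub> w k)"
      using w v by (simp add: N.y_monom_act monom_w[OF ij] N.y_smult_const N.const_smult_const)
    ultimately have "qconst q (q ^ i * \<gamma>) \<odot>\<^bsub>N\<^esub> (qy q \<odot>\<^bsub>N\<^esub> w k) =
      qconst q (q ^ i * \<gamma>) \<odot>\<^bsub>N\<^esub> (qconst q (C2 * q powi (p2 * (k + d2))) \<odot>\<^bsub>N\<^esub> w (k + d2))"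
      using w by (simp add: N.const_smult_const mult_ac)
    then show ?thesis by (rule cancel) (use ij(1) w in simp_all)
  qed
  define \<phi> where "\<phi> f = finsum N (\<lambda>k. qconst q (Poly_Mapping.lookup f k) \<odot>\<^bsub>N\<^esub> w k) (Poly_Mapping.keys f)"
    for f :: laurent
  \<comment> \<open>Freedom to enlarge the index set lets polynomials with different supports be
    summed over a common one.\<close>
  have phi_eq: "\<phi> f = finsum N (\<lambda>k. qconst q (Poly_Mapping.lookup f k) \<odot>\<^bsub>N\<^esub> w k) S"
    if "finite S" "Poly_Mapping.keys f \<subseteq> S" for f S
    unfolding \<phi>_def using that w
    by (intro N.M.add.finprod_mono_neutral_cong_left) (auto simp: in_keys_iff)
  have closed: "\<phi> f \<in> carrier N" for f
    unfolding \<phi>_def using w by (intro N.M.finsum_closed) auto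
  have add: "\<phi> (f + g) = \<phi> f \<oplus>\<^bsub>N\<^esub> \<phi> g" for f g
  proof -
    let ?S = "Poly_Mapping.keys f \<union> Poly_Mapping.keys g"
    have "\<phi> (f + g) = finsum N (\<lambda>k. qconst q (Poly_Mapping.lookup (f + g) k) \<odot>\<^bsub>N\<^esub> w k) ?S"
      by (intro phi_eq) (use Poly_Mapping.keys_add[of f g] in auto)
    also have "\<dots> = finsum N (\<lambda>k. qconst q (Poly_Mapping.lookup f k) \<odot>\<^bsub>N\<^esub> w k \<oplus>\<^bsub>N\<^esub>
        qconst q (Poly_Mapping.lookup g k) \<odot>\<^bsub>N\<^esub> w k) ?S"
      using w by (intro N.M.finsum_cong') (auto simp: lookup_add N.const_smult_add)
    also have "\<dots> = \<phi> f \<oplus>\<^bsub>N\<^esub> \<phi> g"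
      using w by (subst N.M.finsum_addf) (auto simp: phi_eq[of ?S])
    finally show ?thesis .
  qed
  have phi_single: "\<phi> (Poly_Mapping.single k c) = qconst q c \<odot>\<^bsub>N\<^esub> w k" for k c
    using w by (subst phi_eq[of "{k}"]) (auto simp: N.M.finsum_insert N.M.finsum_empty)
  have gens: "\<phi> (u \<odot>\<^bsub>M\<^esub> f) = u \<odot>\<^bsub>N\<^esub> \<phi> f"
    if u: "u \<in> carrier (qplane q)"
      and single: "\<And>k c. \<phi> (u \<odot>\<^bsub>M\<^esub> Poly_Mapping.single k c) = u \<odot>\<^bsub>N\<^esub> \<phi> (Poly_Mapping.single k c)"
    for u f
  proof (induction f rule: poly_mapping_single_add_induct)
    case (add f g)
    then show ?case
      using smult_r_distr[OF u, of f g] N.smult_r_distr[OF u closed closed, of f g]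
      by (simp add: \<open>\<And>f g. \<phi> (f + g) = \<phi> f \<oplus>\<^bsub>N\<^esub> \<phi> g\<close>)
  qed (rule single)
  have smult: "\<phi> (u \<odot>\<^bsub>M\<^esub> f) = u \<odot>\<^bsub>N\<^esub> \<phi> f" if "u \<in> carrier (qplane q)" for u f
  proof (rule qplane_hom_of_gens[OF left_module_axioms N.left_module_axioms, where \<phi> = \<phi>])
    show "\<phi> (qconst q c \<odot>\<^bsub>M\<^esub> f) = qconst q c \<odot>\<^bsub>N\<^esub> \<phi> f" for c f
      by (rule gens) (use w in \<open>auto simp: const_single phi_single N.const_smult_const\<close>)
    show "\<phi> (qx q \<odot>\<^bsub>M\<^esub> f) = qx q \<odot>\<^bsub>N\<^esub> \<phi> f" for f
      by (rule gens) (use w in \<open>auto simp: x_single phi_single N.x_smult_const x_w N.const_smult_const mult_ac\<close>)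
    show "\<phi> (qy q \<odot>\<^bsub>M\<^esub> f) = qy q \<odot>\<^bsub>N\<^esub> \<phi> f" for f
      by (rule gens) (use w in \<open>auto simp: y_single phi_single N.y_smult_const y_w N.const_smult_const mult_ac\<close>)
  qed (use that closed add in auto)
  \<comment> \<open>The empty monomial leads from \<open>t^n\<close> to itself with coefficient 1,
    whence \<open>w n = v\<close>.\<close>
  have "\<phi> (Poly_Mapping.single n 1) = v"
    using monom_w[of 1 0 0 n] w v by (simp add: phi_single monom_act_def N.monom_act_def)
  then show ?thesis
    using simple simple_N closed add smult v
    by (intro simple_hom_isomorphic[of q M N \<phi> "Poly_Mapping.single n 1"]) auto
qed

end

end

section \<open>Twists of the basic module\<close>

lemma (in left_module) smult_inv:
  assumes "u \<in> Units R" "v \<in> carrier M"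
  shows "inv\<^bsub>R\<^esub> u \<odot>\<^bsub>M\<^esub> (u \<odot>\<^bsub>M\<^esub> v) = v"
proof -
  have "u \<in> carrier R" using assms(1) by (rule R.Units_closed)
  then show ?thesis using assms by (simp add: smult_assoc1[symmetric])
qed

section \<open>Integer powers of the generators acting on the basic module\<close>

context
  fixes q :: complex and V :: "(qtorus_elt, laurent) module"
  assumes q_nz: "q \<noteq> 0" and V: "basic_module q V"
begin

interpretation left_module "qtorus q" V
  using V by (simp add: basic_module_def)

lemma basic_carrier [simp]: "carrier V = UNIV"
  and basic_add: "f \<oplus>\<^bsub>V\<^esub> g = f + g"
  and basic_const: "qconst q c \<odot>\<^bsub>V\<^esub> f = Poly_Mapping.single 0 c * f"
  and basic_x: "qx q \<odot>\<^bsub>V\<^esub> f = dilate q f"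
  and basic_y: "qy q \<odot>\<^bsub>V\<^esub> f = Poly_Mapping.single 1 1 * f"
  using V by (auto simp: basic_module_def)

lemma basic_zero: "\<zero>\<^bsub>V\<^esub> = 0"
  using M.l_zero[of 0] by (simp add: basic_add)

lemma basic_x_single: "qx q \<odot>\<^bsub>V\<^esub> Poly_Mapping.single n c = Poly_Mapping.single n (q powi n * c)"
  \<comment> \<open>For \<open>c = 0\<close> the sum in \<open>dilate\<close> is empty; otherwise
    \<open>n\<close> is its only key.\<close>
  by (cases "c = 0") (simp_all add: basic_x dilate_def mult.commute)

lemma basic_y_single: "qy q \<odot>\<^bsub>V\<^esub> Poly_Mapping.single n c = Poly_Mapping.single (n + 1) c"
  by (simp add: basic_y mult_single add.commute)

lemma basic_x_nat_pow_single:
  "qx q [^]\<^bsub>qtorus q\<^esub> (m::nat) \<odot>\<^bsub>V\<^esub> Poly_Mapping.single n c =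
    Poly_Mapping.single n (q powi (int m * n) * c)"
proof (induction m arbitrary: c)
  case (Suc m)
  then show ?case
    using q_nz by (simp add: smult_assoc1 basic_x_single power_int_add algebra_simps)
qed simp

lemma basic_y_nat_pow_single:
  "qy q [^]\<^bsub>qtorus q\<^esub> (m::nat) \<odot>\<^bsub>V\<^esub> Poly_Mapping.single n c = Poly_Mapping.single (n + int m) c"
proof (induction m arbitrary: n)
  case (Suc m)
  then show ?case
    by (simp add: smult_assoc1 basic_y_single algebra_simps)
qed simp

lemma basic_x_pow_single:
  "qx q [^]\<^bsub>qtorus q\<^esub> (z::int) \<odot>\<^bsub>V\<^esub> Poly_Mapping.single n c = Poly_Mapping.single n (q powi (z * n) * c)"
proof (cases "z < 0")
  case False
  then obtain m where "z = int m" by (metis nonneg_int_cases not_less)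
  then show ?thesis by (simp only: int_pow_int basic_x_nat_pow_single)
next
  case True
  then obtain m where m: "z = - int m" by (metis less_imp_le nonpos_int_cases)
  \<comment> \<open>A negative power is the inverse of the natural power \<open>?u\<close>. The
    claimed value is verified by letting \<open>?u\<close> carry it back to the original
    monomial.\<close>
  let ?u = "qx q [^]\<^bsub>qtorus q\<^esub> m"
  have "?u \<odot>\<^bsub>V\<^esub> Poly_Mapping.single n (q powi (z * n) * c) = Poly_Mapping.single n c"
    unfolding m using q_nz by (simp only: basic_x_nat_pow_single) (simp add: power_int_minus mult.assoc[symmetric])
  moreover have "inv\<^bsub>qtorus q\<^esub> ?u \<odot>\<^bsub>V\<^esub> (?u \<odot>\<^bsub>V\<^esub> Poly_Mapping.single n (q powi (z * n) * c)) = Poly_Mapping.single n (q powi (z * n) * c)"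
    by (intro smult_inv qtorus.Units_pow_closed qx_Units) simp
  moreover have "qx q [^]\<^bsub>qtorus q\<^esub> z = inv\<^bsub>qtorus q\<^esub> ?u"
    using True unfolding int_pow_def2 by (simp only: if_True m add.inverse_inverse nat_int)
  ultimately show ?thesis by simp
qed

lemma basic_y_pow_single:
  "qy q [^]\<^bsub>qtorus q\<^esub> (z::int) \<odot>\<^bsub>V\<^esub> Poly_Mapping.single n c = Poly_Mapping.single (n + z) c"
proof (cases "z < 0")
  case False
  then obtain m where "z = int m" by (metis nonneg_int_cases not_less)
  then show ?thesis by (simp only: int_pow_int basic_y_nat_pow_single)
next
  case True
  then obtain m where m: "z = - int m" by (metis less_imp_le nonpos_int_cases)
  let ?u = "qy q [^]\<^bsub>qtorus q\<^esub> m"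
  have "?u \<odot>\<^bsub>V\<^esub> Poly_Mapping.single (n + z) c = Poly_Mapping.single n c"
    unfolding m by (simp only: basic_y_nat_pow_single) simp
  moreover have "inv\<^bsub>qtorus q\<^esub> ?u \<odot>\<^bsub>V\<^esub> (?u \<odot>\<^bsub>V\<^esub> Poly_Mapping.single (n + z) c) = Poly_Mapping.single (n + z) c"
    by (intro smult_inv qtorus.Units_pow_closed qy_Units) simp
  moreover have "qy q [^]\<^bsub>qtorus q\<^esub> z = inv\<^bsub>qtorus q\<^esub> ?u"
    using True unfolding int_pow_def2 by (simp only: if_True m add.inverse_inverse nat_int)
  ultimately show ?thesis by simp
qed

lemma basic_monomial_single:
  "(qconst q C \<otimes>\<^bsub>qtorus q\<^esub> (qx q [^]\<^bsub>qtorus q\<^esub> (z::int) \<otimes>\<^bsub>qtorus q\<^esub> qy q [^]\<^bsub>qtorus q\<^esub> (z'::int)))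
      \<odot>\<^bsub>V\<^esub> Poly_Mapping.single n c =
    Poly_Mapping.single (n + z') (C * q powi (z * (n + z')) * c)"
proof -
  have closed: "u [^]\<^bsub>qtorus q\<^esub> (z::int) \<in> carrier (qtorus q)" if "u \<in> Units (qtorus q)" for u z
  proof (cases "z < 0")
    case True
    show ?thesis
      unfolding int_pow_def2 if_P[OF True]
      by (intro qtorus.Units_inv_closed qtorus.Units_pow_closed that)
  next
    case False
    show ?thesis
      unfolding int_pow_def2 if_not_P[OF False]
      by (intro qtorus.nat_pow_closed qtorus.Units_closed that)
  qed
  show ?thesis
    using closed[OF qx_Units] closed[OF qy_Units]
    by (simp add: smult_assoc1 basic_y_pow_single basic_x_pow_single basic_const mult_single mult.assoc)
qed

text \<open>Elements of the plane are sent by \<open>\<tau>\<close> into the torus, possibly outside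
  the plane, and act through the torus module, from which the axioms are inherited.\<close>

lemma left_module_twist:
  assumes "\<tau> \<in> ring_hom (qtorus q) (qtorus q)"
  shows "left_module (qplane q) (twist \<tau> V)"
proof (intro left_module.intro left_module_axioms.intro)
  show "ring (qplane q)" by (rule ring_qplane)
  show "abelian_group (twist \<tau> V)"
    using M.abelian_group_axioms
    by (simp add: twist_def abelian_group_def abelian_monoid_def abelian_group_axioms_def)
qed (use ring_hom_memE[OF assms] qplane_carrier_subset[of q] in
    \<open>auto simp: twist_def qplane_simps(2-5) subset_iff smult_l_distr smult_r_distr smult_assoc1\<close>)

end

no_notation fps_nth (infixl "$" 75)


theorem theorem6p1:
  fixes q :: complex
    and V :: "(qtorus_elt, laurent) module"
    and A :: "int^2^2"
    and c :: "complex^2"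
    and \<tau> :: "qtorus_elt \<Rightarrow> qtorus_elt"
    and L :: "(qtorus_elt, 'm) module"
  assumes "generic q"
    and "basic_module q V"
    and "det A = 1"
    and "c $ 1 \<noteq> 0" and "c $ 2 \<noteq> 0"
    and "\<tau> \<in> qtorus_auts q"
    and "\<tau> (qx q) =
           qconst q (c $ 1 powi (A $ 1 $ 1) * c $ 2 powi (A $ 2 $ 1)) \<otimes>\<^bsub>qtorus q\<^esub>
           (qx q [^]\<^bsub>qtorus q\<^esub> (A $ 1 $ 1) \<otimes>\<^bsub>qtorus q\<^esub> qy q [^]\<^bsub>qtorus q\<^esub> (A $ 2 $ 1))"
    and "\<tau> (qy q) =
           qconst q (c $ 1 powi (A $ 1 $ 2) * c $ 2 powi (A $ 2 $ 2)) \<otimes>\<^bsub>qtorus q\<^esub>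
           (qx q [^]\<^bsub>qtorus q\<^esub> (A $ 1 $ 2) \<otimes>\<^bsub>qtorus q\<^esub> qy q [^]\<^bsub>qtorus q\<^esub> (A $ 2 $ 2))"
  shows "(simple_module (qplane q) (twist \<tau> V) \<longleftrightarrow> A $ 2 $ 1 * A $ 2 $ 2 < 0) \<and>
    (A $ 2 $ 1 * A $ 2 $ 2 < 0 \<longrightarrow>
       (let a = nat \<bar>A $ 2 $ 2\<bar>; b = nat \<bar>A $ 2 $ 1\<bar>;
            \<Lambda> = qZ_class q (c $ 1 powi sgn (A $ 2 $ 2))
        in is_L q a b \<Lambda> (twist \<tau> V) \<and>
           (is_L q a b \<Lambda> L \<longrightarrow> module_isomorphic (qplane q) (twist \<tau> V) L)))"
proof -
  define a11 a12 a21 a22 where entries: "a11 = A $ 1 $ 1" "a12 = A $ 1 $ 2" "a21 = A $ 2 $ 1" "a22 = A $ 2 $ 2"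
  define C1 C2 where C: "C1 = c $ 1 powi a11 * c $ 2 powi a21" "C2 = c $ 1 powi a12 * c $ 2 powi a22"
  define M where "M = twist \<tau> V"
  note c_nz = assms(4,5)
  have q_nz: "q \<noteq> 0" using assms(1) by (simp add: generic_def)
  note V = q_nz assms(2)
  have det: "a11 * a22 - a12 * a21 = 1"
    using assms(3) by (simp add: det_2 entries)
  have hom: "\<tau> \<in> ring_hom (qtorus q) (qtorus q)"
    and tau_const: "\<tau> (qconst q d) = qconst q d" for d
    using assms(6) by (auto simp: qtorus_auts_def ring_iso_def)
  interpret M: qplane_laurent_module q M a21 a22 a11 a12 C1 C2
  proof (intro qplane_laurent_module.intro qplane_module.intro qplane_laurent_module_axioms.intro)
    show "left_module (qplane q) M"
      unfolding M_def by (rule left_module_twist[OF V hom])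
    show "qx q \<odot>\<^bsub>M\<^esub> Poly_Mapping.single n d =
        Poly_Mapping.single (n + a21) (C1 * q powi (a11 * (n + a21)) * d)" for n d
      using assms(7) by (simp add: M_def twist_def basic_monomial_single[OF V] entries C)
    show "qy q \<odot>\<^bsub>M\<^esub> Poly_Mapping.single n d =
        Poly_Mapping.single (n + a22) (C2 * q powi (a12 * (n + a22)) * d)" for n d
      using assms(8) by (simp add: M_def twist_def basic_monomial_single[OF V] entries C)
  qed (use assms(1) c_nz det in \<open>auto simp: M_def twist_def basic_carrier[OF V] basic_add[OF V]
      basic_zero[OF V] basic_const[OF V] tau_const C mult.commute\<close>)
  define a b where ab: "a = nat \<bar>a22\<bar>" "b = nat \<bar>a21\<bar>"
  have "simple_module (qplane q) M \<longleftrightarrow> a21 * a22 < 0"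
    using M.not_simple M.simple[OF _ refl refl refl] by blast
  moreover have "is_L q a b (qZ_class q (c $ 1 powi sgn a22)) M \<and>
    (is_L q a b (qZ_class q (c $ 1 powi sgn a22)) L \<longrightarrow> module_isomorphic (qplane q) M L)"
    if neg: "a21 * a22 < 0"
  proof -
    note ctx = neg ab refl[of "sgn a22"]
    have ia: "int a = sgn a22 * a22" and ib: "int b = - sgn a22 * a21"
      by (rule M.ab_eq(1)[OF ctx], rule M.ab_eq(2)[OF ctx])
    \<comment> \<open>Collecting powers, the exponent of \<open>c $ 1\<close> becomes
      \<open>sgn a22\<close> times the determinant and that of \<open>c $ 2\<close> vanishes; this
      produces the coset in the claim.\<close>
    have "C1 ^ a * C2 ^ b = c $ 1 powi (a11 * int a + a12 * int b) * c $ 2 powi (a21 * int a + a22 * int b)"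
      using c_nz by (simp add: C power_mult_distrib power_int_mult power_int_add mult_ac)
    also have "a11 * int a + a12 * int b = sgn a22 * (a11 * a22 - a12 * a21)"
      by (simp add: ia ib algebra_simps)
    also have "a21 * int a + a22 * int b = 0"
      by (simp add: ia ib algebra_simps)
    finally have \<Lambda>: "range (M.eigval a b) = qZ_class q (c $ 1 powi sgn a22)"
      using M.eigval_class[OF ctx] by (simp add: det)
    have simple: "simple_module (qplane q) M"
      by (rule M.simple[OF ctx])
    \<comment> \<open>The constant \<open>t^0\<close> serves as the cyclic eigenvector of
      \<open>K\<close>.\<close>
    have eigen: "qK q a b \<odot>\<^bsub>M\<^esub> Poly_Mapping.single 0 1 =
        qconst q (M.eigval a b 0) \<odot>\<^bsub>M\<^esub> Poly_Mapping.single 0 1"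
      by (rule M.qK_single[OF ctx])
    have nz: "Poly_Mapping.single (0::int) (1::complex) \<noteq> \<zero>\<^bsub>M\<^esub>"
      using single_one_nz[of "0::int", where 'b = complex] by (simp only: M.zero_eq not_False_eq_True)
    have "is_L q a b (qZ_class q (c $ 1 powi sgn a22)) M"
      unfolding is_L_def \<Lambda>[symmetric]
    proof (intro conjI bexI)
      show "carrier M = (\<lambda>u. u \<odot>\<^bsub>M\<^esub> Poly_Mapping.single 0 1) ` carrier (qplane q)"
        by (rule M.simple_cyclic[OF simple _ nz]) (simp only: M.carrier_eq UNIV_I)
    qed (rule simple nz eigen rangeI | simp only: M.carrier_eq UNIV_I)+
    moreover have "module_isomorphic (qplane q) M L"
      if L: "is_L q a b (qZ_class q (c $ 1 powi sgn a22)) L"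
    proof -
      \<comment> \<open>The eigenvalue in \<open>L\<close> lies in the coset, hence equals that of
        some \<open>t^n\<close>, whatever representative was chosen.\<close>
      obtain n v where "simple_module (qplane q) L" "v \<in> carrier L" "v \<noteq> \<zero>\<^bsub>L\<^esub>"
        "qK q a b \<odot>\<^bsub>L\<^esub> v = qconst q (M.eigval a b n) \<odot>\<^bsub>L\<^esub> v"
        using L unfolding is_L_def \<Lambda>[symmetric] by blast
      then show ?thesis by (rule M.isomorphic[OF ctx])
    qed
    ultimately show ?thesis by blast
  qed
  ultimately show ?thesis
    by (simp add: M_def entries ab Let_def)
qed

end
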